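(* The B-Z constant of the family $\mathcal{C}_2=\{C_n^2 : n\ge 5\}$ of squares of cycles exists and equals $$BZ(\mathcal{C}_2)=\lim_{n\to\infty}\frac{\sum_{T\in\mathcal{T}(C_n^2)}|\mathcal{L}(T)|}{n\cdot\tau(C_n^2)}=-6+\frac{14\sqrt{5}}{5}.$$
   Context: All graphs are finite and simple. $C_n$ is the cycle graph on $n$ vertices. For a graph $G$ and $k\ge1$, the $k$-th power $G^k$ has $V(G^k)=V(G)$, and $uv$ is an edge iff the distance between $u$ and $v$ in $G$ is at least $1$ and at most $k$. $\mathcal{T}(G)$ is the set of labeled spanning trees of $G$, $\tau(G)=|\mathcal{T}(G)|$, and $\mathcal{L}(T)$ is the set of leaves (vertices of degree exactly $1$ in $T$) of a tree $T$. For a graph family $\mathcal{G}$ indexed by number of vertices, with $G_n$ the member on $n$ vertices, the B-Z constant is $BZ(\mathcal{G}):=\lim_{n\to\infty}\frac{\sum_{T\in\mathcal{T}(G_n)}|\mathcal{L}(T)|}{n\,\tau(G_n)}$ whenever the limit exists. *)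

theory Defs
  imports Complex_Main "HOL-Library.Extended_Nat"
begin

text \<open>
  Undirected graphs are given by a vertex set and a set of edges, each edge being the
  two-element set of its end points.
\<close>

record 'a ugraph =
  verts :: "'a set"
  edges :: "'a set set"

definition simple_graph :: "'a ugraph \<Rightarrow> bool" where
  "simple_graph G \<longleftrightarrow>
     finite (verts G) \<and> (\<forall>e \<in> edges G. e \<subseteq> verts G \<and> card e = 2)"

definition adjacent :: "'a ugraph \<Rightarrow> 'a \<Rightarrow> 'a \<Rightarrow> bool" where
  "adjacent G u v \<longleftrightarrow> {u, v} \<in> edges G"

text \<open>
  A path is the list of its vertices, so its number of edges is one less than its length;
  a single vertex is a path with no edge.
\<close>

definition path_between :: "'a ugraph \<Rightarrow> 'a \<Rightarrow> 'a list \<Rightarrow> 'a \<Rightarrow> bool" where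
  "path_between G u p v \<longleftrightarrow>
     p \<noteq> [] \<and> hd p = u \<and> last p = v \<and> set p \<subseteq> verts G \<and> distinct p \<and>
     (\<forall>i. Suc i < length p \<longrightarrow> adjacent G (p ! i) (p ! Suc i))"

text \<open>The infimum of the empty set is \<open>\<infinity>\<close>: vertices not joined by a path have infinite distance.\<close>

definition graph_dist :: "'a ugraph \<Rightarrow> 'a \<Rightarrow> 'a \<Rightarrow> enat" where
  "graph_dist G u v = (INF p \<in> {p. path_between G u p v}. enat (length p - 1))"

definition graph_power :: "'a ugraph \<Rightarrow> nat \<Rightarrow> 'a ugraph" where
  "graph_power G k =
     \<lparr>verts = verts G,
      edges = {{u, v} | u v. u \<in> verts G \<and> v \<in> verts G \<and>
                 1 \<le> graph_dist G u v \<and> graph_dist G u v \<le> enat k}\<rparr>"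

text \<open>This is the cycle graph, and a simple graph, for \<open>n \<ge> 3\<close> only.\<close>

definition cycle_graph :: "nat \<Rightarrow> nat ugraph" where
  "cycle_graph n = \<lparr>verts = {..<n}, edges = {{i, (i + 1) mod n} | i. i < n}\<rparr>"

definition connected_graph :: "'a ugraph \<Rightarrow> bool" where
  "connected_graph G \<longleftrightarrow>
     verts G \<noteq> {} \<and> (\<forall>u \<in> verts G. \<forall>v \<in> verts G. \<exists>p. path_between G u p v)"

definition is_cycle :: "'a ugraph \<Rightarrow> 'a list \<Rightarrow> bool" where
  "is_cycle G c \<longleftrightarrow>
     length c \<ge> 3 \<and> path_between G (hd c) c (last c) \<and> adjacent G (last c) (hd c)"

definition is_tree :: "'a ugraph \<Rightarrow> bool" where
  "is_tree T \<longleftrightarrow> simple_graph T \<and> connected_graph T \<and> (\<nexists>c. is_cycle T c)"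

definition spanning_trees :: "'a ugraph \<Rightarrow> 'a ugraph set" where
  "spanning_trees G = {T. is_tree T \<and> verts T = verts G \<and> edges T \<subseteq> edges G}"

definition num_spanning_trees :: "'a ugraph \<Rightarrow> nat" where
  "num_spanning_trees G = card (spanning_trees G)"

definition degree :: "'a ugraph \<Rightarrow> 'a \<Rightarrow> nat" where
  "degree G v = card {e \<in> edges G. v \<in> e}"

definition leaves :: "'a ugraph \<Rightarrow> 'a set" where
  "leaves T = {v \<in> verts T. degree T v = 1}"

text \<open>
  A family is a function \<open>\<G>\<close> whose value at \<open>n\<close> is the member on \<open>n\<close> vertices. Families
  starting at some \<open>n\<^sub>0\<close> are covered, since values below \<open>n\<^sub>0\<close> do not affect the limit.
\<close>

definition BZ_ratio :: "(nat \<Rightarrow> 'a ugraph) \<Rightarrow> nat \<Rightarrow> real" where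
  "BZ_ratio \<G> n =
     real (\<Sum>T \<in> spanning_trees (\<G> n). card (leaves T)) /
     (real n * real (num_spanning_trees (\<G> n)))"

text \<open>Meaningful only if the sequence of ratios converges.\<close>

definition BZ_constant :: "(nat \<Rightarrow> 'a ugraph) \<Rightarrow> real" where
  "BZ_constant \<G> = lim (BZ_ratio \<G>)"

definition squared_cycles :: "nat \<Rightarrow> nat ugraph" where
  "squared_cycles n = graph_power (cycle_graph n) 2"

lemma simple_graph_cycle_graph:
  assumes "n \<ge> 3"
  shows "simple_graph (cycle_graph n)"
proof -
  have "i \<noteq> (i + 1) mod n" if "i < n" for i
    using that assms by (cases "i + 1 = n") auto
  then show ?thesis
    using assms by (auto simp: simple_graph_def cycle_graph_def card_2_iff doubleton_eq_iff)
qed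

lemma graph_dist_self:
  assumes "v \<in> verts G"
  shows "graph_dist G v v = 0"
proof -
  have "path_between G v [v] v"
    using assms by (simp add: path_between_def)
  then have "graph_dist G v v \<le> enat (length [v] - 1)"
    unfolding graph_dist_def by (intro INF_lower) simp
  then show ?thesis by (simp flip: zero_enat_def)
qed

lemma simple_graph_graph_power:
  assumes "finite (verts G)"
  shows "simple_graph (graph_power G k)"
proof -
  have "u \<noteq> v" if "v \<in> verts G" "1 \<le> graph_dist G u v" for u v
    using that graph_dist_self[of v G] by auto
  then show ?thesis
    using assms by (auto simp: simple_graph_def graph_power_def card_2_iff doubleton_eq_iff) blast
qed

lemma finite_spanning_trees:
  assumes "simple_graph G"
  shows "finite (spanning_trees G)"
proof -
  have fin: "finite (edges G)"
    using assms unfolding simple_graph_def by (meson PowI finite_Pow_iff finite_subset subsetI)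
  have "spanning_trees G \<subseteq> (\<lambda>E. \<lparr>verts = verts G, edges = E\<rparr>) ` Pow (edges G)"
    by (auto simp: spanning_trees_def image_iff intro!: ugraph.equality)
  then show ?thesis
    using fin by (meson finite_Pow_iff finite_imageI finite_subset)
qed

end

theory Submission
  imports Defs "HOL-Number_Theory.Fib" "HOL-Number_Theory.Cong"
begin

text \<open>
  Let \<open>G\<close> be the square of the cycle on \<open>n \<ge> 5\<close> vertices. Exchanging the order of summation, the
  number of leaves over all spanning trees is the sum over the vertices \<open>v\<close> of the number of trees
  that have \<open>v\<close> as a leaf. Such a tree is a spanning tree of \<open>G - v\<close> together with one of the edges
  at \<open>v\<close>, so there are \<open>degree G v * \<tau>(G - v)\<close> of them (\<open>card_trees_with_leaf\<close>, \<open>sum_leaves\<close>). All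
  degrees are 4 and all the graphs \<open>G - v\<close> are alike; the ratio is therefore \<open>4 * \<tau>(G - v) / \<tau>(G)\<close>
  and only two tree numbers are needed.

  Both come from one family of multigraphs. Take the square of a long path, with first vertices
  \<open>p\<close>, \<open>q\<close> and last vertices \<open>x\<close>, \<open>y\<close>, and identify some of these four vertices with each other.
  Identifying \<open>x\<close> with \<open>p\<close> and \<open>y\<close> with \<open>q\<close> closes the path up to the square of a cycle. Deleting a
  vertex from the square of a cycle leaves the square of a path and one more edge joining its ends,
  and deletion and contraction of that edge leads back to the family. When the path is lengthened by one
  vertex, deletion and contraction of the two new edges expresses each tree number of the longer path
  through those of the shorter one. So the 15 ways to identify the four vertices give 15 sequences
  with a linear recurrence, whose solutions combine \<open>fib (2 * m)\<close>, \<open>fib (2 * m + 1)\<close> and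
  \<open>(- 1) ^ m\<close> with coefficients at most linear in \<open>m\<close>; this is \<open>tree_count_squared_path\<close>.

  Deletion and contraction take place among lists of edges, where loops and parallel edges are
  harmless (\<open>tree_count_eq\<close>). The link to trees as connected graphs without cycles is
  \<open>is_tree_iff\<close>: the trees are the connected graphs with one edge less than vertices.

  Finally, the terms with a factor \<open>m\<close> dominate both tree numbers, and consecutive Fibonacci numbers
  have the golden ratio as the limit of their quotients (\<open>leaf_ratio_limit\<close>).
\<close>

section \<open>Counting spanning trees by deletion and contraction\<close>

definition contract :: "'a \<Rightarrow> 'a \<Rightarrow> 'a \<Rightarrow> 'a" where
  "contract u v a = (if a = v then u else a)"

text \<open>
  The number of spanning trees of a multigraph with \<open>n\<close> vertices. Of the vertex set only its size
  matters: it decides, once all edges are used up, whether everything has been contracted to a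
  single vertex. Contraction leaves parallel edges and loops in the list.
\<close>

function tree_count :: "nat \<Rightarrow> ('a \<times> 'a) list \<Rightarrow> nat" where
  "tree_count n [] = (if n = 1 then 1 else 0)"
| "tree_count n ((u, v) # es) = tree_count n es +
     (if u = v then 0 else tree_count (n - 1) (map (map_prod (contract u v) (contract u v)) es))"
  by pat_completeness auto
termination by (relation "measure (\<lambda>(n, es). length es)") auto

text \<open>
  Connectedness of \<open>V\<close>, with the pairs in \<open>R\<close> read as undirected edges.
\<close>

definition linked :: "'a set \<Rightarrow> ('a \<times> 'a) set \<Rightarrow> bool" where
  "linked V R \<longleftrightarrow> V \<times> V \<subseteq> (R \<union> R\<inverse>)\<^sup>*"

lemma rtrancl_map_prod_sym:
  assumes "(a, b) \<in> (R \<union> R\<inverse>)\<^sup>*"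
    and "\<And>s t. (s, t) \<in> R \<Longrightarrow> (f s, f t) \<in> (S \<union> S\<inverse>)\<^sup>*"
  shows "(f a, f b) \<in> (S \<union> S\<inverse>)\<^sup>*"
  using assms(1)
proof (induction rule: rtrancl_induct)
  case (step s t)
  have "sym ((S \<union> S\<inverse>)\<^sup>*)"
    by (intro sym_rtrancl sym_Un_converse)
  then have "(f s, f t) \<in> (S \<union> S\<inverse>)\<^sup>*"
    using step(2) assms(2) by (auto dest: symD)
  with step.IH show ?case by (rule rtrancl_trans)
qed simp

text \<open>
  A walk is mapped by the contraction to a walk. Conversely a walk after contraction lifts, because
  a vertex and its image under the contraction are either equal or joined by the contracted edge.
\<close>

lemma linked_contract:
  fixes u v :: 'a
  assumes "u \<noteq> v" "u \<in> V" "v \<in> V"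
  defines "c \<equiv> contract u v"
  shows "linked V (insert (u, v) R) \<longleftrightarrow> linked (V - {v}) (map_prod c c ` R)" (is "linked V ?I \<longleftrightarrow> linked _ ?C")
proof
  assume *: "linked V ?I"
  show "linked (V - {v}) ?C"
    unfolding linked_def
  proof (intro subrelI)
    fix a b assume ab: "(a, b) \<in> (V - {v}) \<times> (V - {v})"
    with * have "(a, b) \<in> (?I \<union> ?I\<inverse>)\<^sup>*"
      by (auto simp: linked_def)
    then have "(c a, c b) \<in> (?C \<union> ?C\<inverse>)\<^sup>*"
    proof (rule rtrancl_map_prod_sym)
      fix s t assume "(s, t) \<in> ?I"
      then consider "c s = c t" | "(s, t) \<in> R"
        by (auto simp: c_def contract_def)
      then show "(c s, c t) \<in> (?C \<union> ?C\<inverse>)\<^sup>*"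
      proof cases
        case 2
        from imageI[OF this, of "map_prod c c"] have "(c s, c t) \<in> ?C"
          by simp
        then show ?thesis
          by (intro r_into_rtrancl UnI1)
      qed simp
    qed
    then show "(a, b) \<in> (?C \<union> ?C\<inverse>)\<^sup>*"
      using ab by (simp add: c_def contract_def)
  qed
next
  assume *: "linked (V - {v}) ?C"
  let ?S = "(?I \<union> ?I\<inverse>)\<^sup>*"
  have c: "(a, c a) \<in> ?S" "(c a, a) \<in> ?S" for a
    by (auto simp: c_def contract_def)
  show "linked V ?I"
    unfolding linked_def
  proof (intro subrelI)
    fix a b assume "(a, b) \<in> V \<times> V"
    then have "(c a, c b) \<in> (V - {v}) \<times> (V - {v})"
      using assms by (auto simp: c_def contract_def)
    with * have "(c a, c b) \<in> (?C \<union> ?C\<inverse>)\<^sup>*"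
      by (auto simp: linked_def)
    then have "(id (c a), id (c b)) \<in> ?S"
    proof (rule rtrancl_map_prod_sym)
      fix s t assume "(s, t) \<in> ?C"
      then obtain s' t' where st: "s = c s'" "t = c t'" "(s', t') \<in> R"
        by auto
      then have "(s', t') \<in> ?S"
        by auto
      with c(2)[of s'] c(1)[of t'] st show "(id s, id t) \<in> ?S"
        by (metis id_apply rtrancl_trans)
    qed
    with c(1)[of a] c(2)[of b] show "(a, b) \<in> ?S"
      by (metis id_apply rtrancl_trans)
  qed
qed

lemma linked_insert_loop: "linked V (insert (u, u) R) \<longleftrightarrow> linked V R"
proof -
  have "insert (u, u) R \<union> (insert (u, u) R)\<inverse> = insert (u, u) (R \<union> R\<inverse>)"
    by auto
  moreover have "(insert (u, u) Q)\<^sup>* = Q\<^sup>*" for Q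
    by (intro rtrancl_subset) auto
  ultimately show ?thesis
    by (simp add: linked_def)
qed

definition spanning :: "'a set \<Rightarrow> ('a \<times> 'a) list \<Rightarrow> bool" where
  "spanning V es \<longleftrightarrow> length es + 1 = card V \<and> linked V (set es)"

lemma spanning_contract:
  assumes "u \<noteq> v" "u \<in> V" "v \<in> V" "finite V"
  shows "spanning V ((u, v) # es) \<longleftrightarrow>
    spanning (V - {v}) (map (map_prod (contract u v) (contract u v)) es)"
proof -
  have "card V \<ge> 1"
    using assms by (metis card_0_eq empty_iff less_one not_le)
  then show ?thesis
    using assms by (auto simp: spanning_def linked_contract)
qed

lemma linked_empty_iff: "finite V \<Longrightarrow> linked V {} \<longleftrightarrow> card V \<le> 1"
  by (auto simp: linked_def card_le_Suc0_iff_eq)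

lemma contract_edges:
  assumes "u \<noteq> v" "u \<in> V" "set es \<subseteq> V \<times> V"
  shows "set (map (map_prod (contract u v) (contract u v)) es) \<subseteq> (V - {v}) \<times> (V - {v})"
  using assms by (auto simp: contract_def split: if_splits)

text \<open>
  Every connected multigraph has a spanning tree: a loop can be dropped, and a spanning tree of the
  contraction along an edge becomes one of the whole graph when that edge is added.
\<close>

lemma linked_imp_spanning_subseq:
  assumes "finite V" "V \<noteq> {}" "set es \<subseteq> V \<times> V" "linked V (set es)"
  shows "\<exists>s \<in> set (subseqs es). spanning V s"
  using assms
proof (induction "length es" arbitrary: V es)
  case 0
  then have "card V = 1"
    by (simp add: linked_empty_iff le_Suc_eq)
  with 0 show ?case
    by (simp add: spanning_def)
next
  case (Suc l)
  obtain u v es' where es: "es = (u, v) # es'"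
    using Suc(2) by (metis length_Suc_conv surj_pair)
  have uv: "u \<in> V" "v \<in> V" and es': "set es' \<subseteq> V \<times> V"
    using Suc.prems es by auto
  show ?case
  proof (cases "u = v")
    case True
    then have "linked V (set es')"
      using Suc.prems by (simp add: es linked_insert_loop)
    then show ?thesis
      using Suc.hyps(1)[of es' V] Suc.hyps(2) Suc.prems es' es by (auto simp: Let_def)
  next
    case False
    let ?f = "map_prod (contract u v) (contract u v)"
    have "linked (V - {v}) (set (map ?f es'))"
      using Suc.prems uv False by (simp add: es linked_contract)
    moreover have "V - {v} \<noteq> {}"
      using uv False by auto
    ultimately obtain s where s: "s \<in> set (subseqs (map ?f es'))" "spanning (V - {v}) s"
      using Suc.hyps(1)[of "map ?f es'" "V - {v}"] Suc.hyps(2) Suc.prems(1) es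
        contract_edges[OF False uv(1) es'] by auto
    have "set (subseqs (map ?f es')) = map ?f ` set (subseqs es')"
      by (induction es') (auto simp: Let_def image_Un image_image)
    with s obtain s' where s': "s' \<in> set (subseqs es')" "s = map ?f s'"
      by auto
    then have "spanning V ((u, v) # s')"
      using s False uv Suc.prems(1) by (simp add: spanning_contract)
    then show ?thesis
      using s' by (auto simp: es Let_def)
  qed
qed

lemma linked_imp_card_le:
  assumes "finite V" "set es \<subseteq> V \<times> V" "linked V (set es)"
  shows "card V \<le> length es + 1"
proof (cases "V = {}")
  case False
  then obtain s where "s \<in> set (subseqs es)" "spanning V s"
    using linked_imp_spanning_subseq assms by blast
  moreover have "length s \<le> length es" if "s \<in> set (subseqs es)" for s
    using that by (induction es arbitrary: s) (force simp: Let_def)+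
  ultimately show ?thesis
    by (fastforce simp: spanning_def)
qed simp

lemma map_subseqs: "subseqs (map f xs) = map (map f) (subseqs xs)"
  by (induction xs) (auto simp: Let_def)

text \<open>
  The selections of edges that avoid the first edge \<open>(u, v)\<close> are selections from the rest, and those
  that use it correspond to selections in the contraction. If it is a loop, no selection that uses it
  is counted: the other selected edges are one too few to connect all vertices.
\<close>

theorem tree_count_eq:
  assumes "finite V" "V \<noteq> {}" "set es \<subseteq> V \<times> V"
  shows "tree_count (card V) es = length (filter (spanning V) (subseqs es))"
  using assms
proof (induction "length es" arbitrary: V es)
  case 0
  then show ?case
    by (auto simp: spanning_def linked_empty_iff)
next
  case (Suc l)
  obtain u v es' where es: "es = (u, v) # es'"
    using Suc(2) by (metis length_Suc_conv surj_pair)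
  have uv: "u \<in> V" "v \<in> V" and es': "set es' \<subseteq> V \<times> V"
    using Suc.prems es by auto
  have del: "tree_count (card V) es' = length (filter (spanning V) (subseqs es'))"
    using Suc.hyps(1)[of es' V] Suc.hyps(2) Suc.prems es' es by auto
  have sub: "set s \<subseteq> V \<times> V" if "s \<in> set (subseqs es')" for s
    using that es' subseqs_powset[of es'] by blast
  show ?case
  proof (cases "u = v")
    case True
    have "\<not> spanning V ((u, v) # s)" if "s \<in> set (subseqs es')" for s
      using linked_imp_card_le[OF Suc.prems(1) sub[OF that]] True
      by (auto simp: spanning_def linked_insert_loop)
    then have "filter (spanning V \<circ> (#) (u, v)) (subseqs es') = []"
      by (simp add: filter_empty_conv)
    then show ?thesis
      using True del by (simp add: es Let_def filter_map)
  next
    case False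
    let ?f = "map_prod (contract u v) (contract u v)"
    have "V - {v} \<noteq> {}"
      using uv False by auto
    then have "tree_count (card (V - {v})) (map ?f es') =
        length (filter (spanning (V - {v}) \<circ> map ?f) (subseqs es'))"
      using Suc.hyps(1)[of "map ?f es'" "V - {v}"] Suc.hyps(2) Suc.prems(1) es
        contract_edges[OF False uv(1) es'] by (simp add: map_subseqs filter_map)
    also have "spanning (V - {v}) \<circ> map ?f = spanning V \<circ> (#) (u, v)"
      using False uv Suc.prems(1) by (simp add: fun_eq_iff spanning_contract)
    finally show ?thesis
      using False del uv Suc.prems(1) by (simp add: es Let_def filter_map comp_def)
  qed
qed

text \<open>
  A graph with an isolated vertex has no spanning tree, unless it has no other vertices.
\<close>

lemma tree_count_too_few_vertices:
  assumes "finite U" "set es \<subseteq> U \<times> U" "card U < n" "2 \<le> n"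
  shows "tree_count n es = 0"
  using assms
proof (induction n es arbitrary: U rule: tree_count.induct)
  case (1 n)
  then show ?case by simp
next
  case (2 n u v es)
  have uv: "u \<in> U" "v \<in> U" and es: "set es \<subseteq> U \<times> U"
    using "2.prems" by auto
  have "tree_count (n - 1) (map (map_prod (contract u v) (contract u v)) es) = 0" if "u \<noteq> v"
  proof (rule "2.IH"(2)[OF that, of "U - {v}"])
    have "card {u, v} \<le> card U"
      using uv "2.prems"(1) by (intro card_mono) auto
    then show "2 \<le> n - 1" "card (U - {v}) < n - 1"
      using that "2.prems" uv by auto
    show "set (map (map_prod (contract u v) (contract u v)) es) \<subseteq> (U - {v}) \<times> (U - {v})"
      using es uv that by (auto simp: contract_def split: if_splits)
  qed (use "2.prems" in auto)
  then show ?case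
    using "2.IH"(1)[of U] "2.prems" es by simp
qed

section \<open>Spanning trees of a simple graph\<close>

definition edge :: "'a \<times> 'a \<Rightarrow> 'a set" where
  "edge = (\<lambda>(u, v). {u, v})"

definition adj_rel :: "'a set set \<Rightarrow> ('a \<times> 'a) set" where
  "adj_rel E = {(u, v). {u, v} \<in> E}"

lemma adj_rel_converse [simp]: "(adj_rel E)\<inverse> = adj_rel E"
  by (auto simp: adj_rel_def insert_commute)

lemma linked_edge_image: "linked V (adj_rel (edge ` R)) \<longleftrightarrow> linked V R"
proof -
  have "adj_rel (edge ` R) = R \<union> R\<inverse>"
    by (auto simp: adj_rel_def edge_def doubleton_eq_iff image_iff)
  then show ?thesis
    by (simp add: linked_def converse_Un Un_ac)
qed

text \<open>
  The results on edge lists carry over to simple graphs by giving every edge an orientation.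
\<close>

lemma edge_list_exists:
  assumes "finite E" "\<And>e. e \<in> E \<Longrightarrow> e \<subseteq> V \<and> card e = 2"
  obtains es where "distinct (map edge es)" "edge ` set es = E" "set es \<subseteq> V \<times> V" "length es = card E"
proof -
  have "\<exists>es. distinct (map edge es) \<and> edge ` set es = E \<and> set es \<subseteq> V \<times> V"
    using assms
  proof (induction rule: finite_induct)
    case (insert e E)
    then obtain es where es: "distinct (map edge es)" "edge ` set es = E" "set es \<subseteq> V \<times> V"
      by auto
    obtain u v where "e = {u, v}" "u \<in> V" "v \<in> V"
      using insert.prems[of e] by (auto simp: card_2_iff)
    then have "distinct (map edge ((u, v) # es)) \<and> edge ` set ((u, v) # es) = insert e E \<and>
        set ((u, v) # es) \<subseteq> V \<times> V"
      using es insert.hyps by (auto simp: edge_def)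
    then show ?case by blast
  qed simp
  then show ?thesis
    using that by (metis distinct_card length_map set_map)
qed

lemma linked_adj_imp_card_le:
  assumes "finite V" "finite E" "\<And>e. e \<in> E \<Longrightarrow> e \<subseteq> V \<and> card e = 2" "linked V (adj_rel E)"
  shows "card V \<le> card E + 1"
  using edge_list_exists[of E V] assms linked_imp_card_le linked_edge_image by metis

lemma path_imp_rtrancl:
  assumes "path_between G u p v"
  shows "(u, v) \<in> (adj_rel (edges G))\<^sup>*"
proof -
  have "(hd p, p ! i) \<in> (adj_rel (edges G))\<^sup>*" if "i < length p" for i
    using that
  proof (induction i)
    case 0
    then show ?case by (simp add: hd_conv_nth)
  next
    case (Suc i)
    then have "(p ! i, p ! Suc i) \<in> adj_rel (edges G)"
      using assms by (simp add: path_between_def adjacent_def adj_rel_def)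
    with Suc show ?case
      by (auto intro: rtrancl_into_rtrancl)
  qed
  moreover have "p \<noteq> []" "hd p = u" "last p = v"
    using assms by (simp_all add: path_between_def)
  ultimately show ?thesis
    by (metis diff_less last_conv_nth length_greater_0_conv zero_less_one)
qed

text \<open>
  A path is extended edge by edge; if the next vertex \<open>w\<close> already lies on the path, the path is cut
  off at \<open>w\<close> instead, which keeps its vertices distinct.
\<close>

lemma rtrancl_imp_path:
  assumes "\<And>e. e \<in> edges G \<Longrightarrow> e \<subseteq> verts G"
    and "(u, v) \<in> (adj_rel (edges G))\<^sup>*" "u \<in> verts G"
  shows "\<exists>p. path_between G u p v"
  using assms(2)
proof (induction rule: rtrancl_induct)
  case base
  have "path_between G u [u] u"
    using assms(3) by (simp add: path_between_def)
  then show ?case ..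
next
  case (step v w)
  then obtain p where p: "path_between G u p v"
    by blast
  show ?case
  proof (cases "w \<in> set p")
    case True
    then obtain i where i: "i < length p" "p ! i = w"
      by (auto simp: in_set_conv_nth)
    have "path_between G u (take (Suc i) p) w"
      using p i unfolding path_between_def
      by (auto simp: last_conv_nth dest: in_set_takeD)
    then show ?thesis ..
  next
    case False
    have vw: "adjacent G v w" "w \<in> verts G"
      using step.hyps assms(1) by (auto simp: adj_rel_def adjacent_def)
    have "adjacent G ((p @ [w]) ! i) ((p @ [w]) ! Suc i)" if "Suc i < length (p @ [w])" for i
    proof (cases "Suc i < length p")
      case True
      then show ?thesis
        using p by (simp add: nth_append path_between_def)
    next
      case False
      with that have "i = length p - 1" "p \<noteq> []" by auto
      then show ?thesis
        using p vw by (simp add: nth_append path_between_def last_conv_nth)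
    qed
    then have "path_between G u (p @ [w]) w"
      using p False vw by (auto simp: path_between_def)
    then show ?thesis ..
  qed
qed

lemma connected_graph_iff:
  assumes "simple_graph G"
  shows "connected_graph G \<longleftrightarrow> verts G \<noteq> {} \<and> linked (verts G) (adj_rel (edges G))"
proof -
  have "(\<exists>p. path_between G u p v) \<longleftrightarrow> (u, v) \<in> (adj_rel (edges G))\<^sup>*"
    if "u \<in> verts G" for u v
  proof
    assume "(u, v) \<in> (adj_rel (edges G))\<^sup>*"
    then show "\<exists>p. path_between G u p v"
      using that assms by (intro rtrancl_imp_path) (auto simp: simple_graph_def)
  qed (auto intro: path_imp_rtrancl)
  then show ?thesis
    by (auto simp: connected_graph_def linked_def)
qed

lemma path_in_supergraph:
  assumes "path_between G u p v" "verts G \<subseteq> verts H" "edges G \<subseteq> edges H"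
  shows "path_between H u p v"
  using assms by (auto simp: path_between_def adjacent_def)

text \<open>
  The rest of a cycle is a detour around its closing edge.
\<close>

lemma cycle_closing_edge_redundant:
  assumes "is_cycle G c" "linked (verts G) (adj_rel (edges G))"
  shows "{last c, hd c} \<in> edges G" "linked (verts G) (adj_rel (edges G - {{last c, hd c}}))"
proof -
  let ?e = "{last c, hd c}"
  let ?G = "\<lparr>verts = verts G, edges = edges G - {?e}\<rparr>"
  have c: "length c \<ge> 3" "path_between G (hd c) c (last c)"
    using assms(1) by (auto simp: is_cycle_def)
  show e: "?e \<in> edges G"
    using assms(1) by (auto simp: is_cycle_def adjacent_def)
  have d: "distinct c" and ne: "c \<noteq> []"
    using c by (auto simp: path_between_def)
  have "{c ! i, c ! Suc i} \<noteq> ?e" if "Suc i < length c" for i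
    using that d c(1) ne by (auto simp: hd_conv_nth last_conv_nth doubleton_eq_iff nth_eq_iff_index_eq)
  then have "path_between ?G (hd c) c (last c)"
    using c by (auto simp: path_between_def adjacent_def)
  then have *: "(hd c, last c) \<in> (adj_rel (edges G - {?e}))\<^sup>*"
    using path_imp_rtrancl by fastforce
  moreover have "sym ((adj_rel (edges G - {?e}))\<^sup>*)"
    by (intro sym_rtrancl) (simp add: sym_conv_converse_eq)
  ultimately have "(last c, hd c) \<in> (adj_rel (edges G - {?e}))\<^sup>*"
    by (auto dest: symD)
  with * have "adj_rel (edges G) \<subseteq> (adj_rel (edges G - {?e}))\<^sup>*"
    by (auto simp: adj_rel_def doubleton_eq_iff)
  then have "(adj_rel (edges G))\<^sup>* \<subseteq> (adj_rel (edges G - {?e}))\<^sup>*"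
    by (rule rtrancl_subset_rtrancl)
  then show "linked (verts G) (adj_rel (edges G - {?e}))"
    using assms(2) by (auto simp: linked_def)
qed

text \<open>
  The ends of an edge outside \<open>F\<close> are joined by a path inside \<open>F\<close>, which that edge closes to a cycle.
\<close>

lemma redundant_edge_imp_cycle:
  assumes "simple_graph G" "F \<subset> edges G" "linked (verts G) (adj_rel F)"
  shows "\<exists>c. is_cycle G c"
proof -
  obtain e where e: "e \<in> edges G" "e \<notin> F"
    using assms(2) by auto
  then obtain u v where uv: "e = {u, v}" "u \<noteq> v" "u \<in> verts G" "v \<in> verts G"
    using assms(1) by (auto simp: simple_graph_def card_2_iff)
  let ?F = "\<lparr>verts = verts G, edges = F\<rparr>"
  have "\<exists>p. path_between ?F u p v"
  proof (rule rtrancl_imp_path)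
    show "(u, v) \<in> (adj_rel (edges ?F))\<^sup>*"
      using assms(3) uv by (auto simp: linked_def)
  qed (use assms uv in \<open>auto simp: simple_graph_def\<close>)
  then obtain p where p: "path_between ?F u p v" ..
  have "length p \<ge> 3"
  proof (rule ccontr)
    assume "\<not> length p \<ge> 3"
    then consider "length p = 0" | "length p = 1" | "length p = 2"
      by linarith
    then show False
    proof cases
      case 3
      then obtain a b where "p = [a, b]"
        by (metis length_0_conv length_Suc_conv numeral_2_eq_2)
      then show False
        using p uv e by (auto simp: path_between_def adjacent_def)
    qed (use p uv in \<open>auto simp: path_between_def length_Suc_conv\<close>)
  qed
  moreover have "path_between G u p v"
    using p assms(2) by (intro path_in_supergraph[OF p]) auto
  ultimately have "is_cycle G p"
    using uv e p by (auto simp: is_cycle_def path_between_def adjacent_def insert_commute)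
  then show ?thesis ..
qed

text \<open>
  A connected graph contains a connected subgraph with exactly one edge less than vertices. If it
  has further edges, one of them closes a cycle. If it has no further edges, there is no cycle,
  since an edge of a cycle could be removed without losing connectedness, leaving too few edges.
\<close>

theorem is_tree_iff:
  assumes "simple_graph T"
  shows "is_tree T \<longleftrightarrow> verts T \<noteq> {} \<and> linked (verts T) (adj_rel (edges T)) \<and>
    card (edges T) + 1 = card (verts T)"
proof -
  have fin: "finite (verts T)" "finite (edges T)"
    using assms unfolding simple_graph_def by (auto intro: finite_subset[of _ "Pow (verts T)"])
  have E: "e \<subseteq> verts T \<and> card e = 2" if "e \<in> edges T" for e
    using assms that by (auto simp: simple_graph_def)
  have "(\<nexists>c. is_cycle T c) \<longleftrightarrow> card (edges T) + 1 = card (verts T)"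
    if ne: "verts T \<noteq> {}" and conn: "linked (verts T) (adj_rel (edges T))"
  proof
    assume acyclic: "\<nexists>c. is_cycle T c"
    obtain es where es: "distinct (map edge es)" "edge ` set es = edges T"
      "set es \<subseteq> verts T \<times> verts T" "length es = card (edges T)"
      using edge_list_exists[of "edges T" "verts T"] fin E by metis
    have "linked (verts T) (set es)"
      using conn es by (metis linked_edge_image)
    then obtain s where s: "s \<in> set (subseqs es)" "spanning (verts T) s"
      using linked_imp_spanning_subseq[OF fin(1) ne es(3)] by auto
    have "linked (verts T) (adj_rel (edge ` set s))"
      using s by (simp add: spanning_def linked_edge_image)
    moreover have "edge ` set s \<subseteq> edges T"
      using s es subseqs_powset[of es] by blast
    ultimately have "edge ` set s = edges T"
      using redundant_edge_imp_cycle[OF assms] acyclic by blast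
    then have "card (edges T) \<le> length s"
      by (metis card_image_le card_length finite_set order_trans)
    then show "card (edges T) + 1 = card (verts T)"
      using s linked_adj_imp_card_le[OF fin E conn] by (simp add: spanning_def)
  next
    assume card: "card (edges T) + 1 = card (verts T)"
    show "\<nexists>c. is_cycle T c"
    proof
      assume "\<exists>c. is_cycle T c"
      then obtain c where c: "is_cycle T c" ..
      note redundant = cycle_closing_edge_redundant[OF c conn]
      have "card (verts T) \<le> card (edges T - {{last c, hd c}}) + 1"
        using fin E redundant(2) by (intro linked_adj_imp_card_le) blast+
      with redundant(1) card fin card_Diff1_less[of "edges T" "{last c, hd c}"] show False
        by linarith
    qed
  qed
  then show ?thesis
    using assms connected_graph_iff[OF assms] by (auto simp: is_tree_def)
qed

lemma spanning_trees_iff: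
  assumes "simple_graph G" "verts G \<noteq> {}"
  shows "T \<in> spanning_trees G \<longleftrightarrow> verts T = verts G \<and> edges T \<subseteq> edges G \<and>
    linked (verts G) (adj_rel (edges T)) \<and> card (edges T) + 1 = card (verts G)"
proof (cases "verts T = verts G \<and> edges T \<subseteq> edges G")
  case True
  then have "simple_graph T"
    using assms(1) by (auto simp: simple_graph_def)
  then show ?thesis
    using True assms(2) by (auto simp: spanning_trees_def is_tree_iff)
qed (auto simp: spanning_trees_def)

theorem num_spanning_trees_eq_tree_count:
  assumes "simple_graph G" "verts G \<noteq> {}" "distinct (map edge es)" "edge ` set es = edges G"
  shows "num_spanning_trees G = tree_count (card (verts G)) es"
proof -
  let ?P = "\<lambda>E. linked (verts G) (adj_rel E) \<and> card E + 1 = card (verts G)"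
  have sub: "set es \<subseteq> verts G \<times> verts G"
  proof (intro subrelI)
    fix u v assume "(u, v) \<in> set es"
    then have "{u, v} \<in> edges G"
      unfolding assms(4)[symmetric] by (intro image_eqI[of _ _ "(u, v)"]) (simp_all add: edge_def)
    then show "(u, v) \<in> verts G \<times> verts G"
      using assms(1) by (auto simp: simple_graph_def)
  qed
  let ?Es = "map set (subseqs (map edge es))"
  have "spanning_trees G = (\<lambda>E. \<lparr>verts = verts G, edges = E\<rparr>) ` {E \<in> Pow (edges G). ?P E}"
    (is "_ = ?g ` ?X")
  proof (intro equalityI subsetI)
    fix T assume T: "T \<in> spanning_trees G"
    then have "edges T \<in> ?X" "T = ?g (edges T)"
      using spanning_trees_iff[OF assms(1,2), of T] by auto
    then show "T \<in> ?g ` ?X" by blast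
  qed (auto simp: spanning_trees_iff[OF assms(1,2)])
  then have "num_spanning_trees G = card ?X"
    unfolding num_spanning_trees_def by (simp add: card_image inj_on_def)
  also have "?X = set (filter ?P ?Es)"
    using subseqs_powset[of "map edge es"] assms(4) by auto
  also have "card \<dots> = length (filter ?P ?Es)"
    using assms(3) by (intro distinct_card distinct_filter distinct_set_subseqs)
  also have "\<dots> = length (filter (\<lambda>s. ?P (set (map edge s))) (subseqs es))"
    by (simp add: map_subseqs filter_map comp_def)
  also have "filter (\<lambda>s. ?P (set (map edge s))) (subseqs es) = filter (spanning (verts G)) (subseqs es)"
  proof (rule filter_cong[OF refl])
    fix s assume "s \<in> set (subseqs es)"
    then have "distinct (map edge s)"
      using subseqs_distinctD[of "map edge s" "map edge es"] assms(3) by (simp add: map_subseqs)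
    then have "card (set (map edge s)) = length s"
      by (metis distinct_card length_map)
    then show "?P (set (map edge s)) \<longleftrightarrow> spanning (verts G) s"
      by (auto simp: spanning_def linked_edge_image)
  qed
  also have "length (filter (spanning (verts G)) (subseqs es)) = tree_count (card (verts G)) es"
    using assms sub by (intro tree_count_eq[symmetric]) (auto simp: simple_graph_def)
  finally show ?thesis .
qed

section \<open>Trees in which a given vertex is a leaf\<close>

definition delete_vertex :: "'a ugraph \<Rightarrow> 'a \<Rightarrow> 'a ugraph" where
  "delete_vertex G v = \<lparr>verts = verts G - {v}, edges = {e \<in> edges G. v \<notin> e}\<rparr>"

lemma linked_Un_converse: "linked V (R \<union> R\<inverse>) \<longleftrightarrow> linked V R"
  by (simp add: linked_def converse_Un Un_ac)

text \<open>
  This is \<open>linked_contract\<close> for the only edge at \<open>v\<close>: the contraction then changes no other edge.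
\<close>

lemma linked_insert_pendant_edge:
  assumes "w \<noteq> v" "w \<in> V" "v \<in> V" "\<And>e. e \<in> E \<Longrightarrow> v \<notin> e"
  shows "linked V (adj_rel (insert {w, v} E)) \<longleftrightarrow> linked (V - {v}) (adj_rel E)"
proof -
  let ?c = "contract w v"
  have "adj_rel (insert {w, v} E) = insert (w, v) (adj_rel E) \<union> (insert (w, v) (adj_rel E))\<inverse>"
    by (auto simp: adj_rel_def doubleton_eq_iff insert_commute)
  then have "linked V (adj_rel (insert {w, v} E)) \<longleftrightarrow> linked V (insert (w, v) (adj_rel E))"
    by (simp only: linked_Un_converse)
  also have "\<dots> \<longleftrightarrow> linked (V - {v}) (map_prod ?c ?c ` adj_rel E)"
    by (rule linked_contract) fact+
  also have "map_prod ?c ?c ` adj_rel E = id ` adj_rel E"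
  proof (rule image_cong[OF refl])
    fix x assume "x \<in> adj_rel E"
    then obtain a b where x: "x = (a, b)" "{a, b} \<in> E"
      by (auto simp: adj_rel_def)
    then show "map_prod ?c ?c x = id x"
      using assms(4)[of "{a, b}"] by (auto simp: contract_def)
  qed
  finally show ?thesis
    by simp
qed

text \<open>
  A leaf \<open>v\<close> can be removed together with its edge, and conversely any edge at \<open>v\<close> can be attached
  to any spanning tree of the graph without \<open>v\<close>.
\<close>

theorem card_trees_with_leaf:
  assumes G: "simple_graph G" and v: "v \<in> verts G" and two: "card (verts G) \<ge> 2"
  shows "card {T \<in> spanning_trees G. v \<in> leaves T} =
    degree G v * num_spanning_trees (delete_vertex G v)"
proof -
  let ?H = "delete_vertex G v"
  let ?N = "{e \<in> edges G. v \<in> e}"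
  let ?g = "\<lambda>(e, T). \<lparr>verts = verts G, edges = insert e (edges T)\<rparr>"
  have fin: "finite (verts G)" "finite (edges G)"
    using G unfolding simple_graph_def by (auto intro: finite_subset[of _ "Pow (verts G)"])
  have H: "simple_graph ?H"
    using G by (auto simp: simple_graph_def delete_vertex_def)
  have neG: "verts G \<noteq> {}"
    using v by auto
  have cardH: "card (verts ?H) = card (verts G) - 1"
    using v fin by (simp add: delete_vertex_def)
  then have neH: "verts ?H \<noteq> {}"
    using two by auto
  have tree_iff: "\<lparr>verts = verts G, edges = insert e E\<rparr> \<in> spanning_trees G \<longleftrightarrow>
      \<lparr>verts = verts ?H, edges = E\<rparr> \<in> spanning_trees ?H"
    if e: "e \<in> ?N" and E: "E \<subseteq> edges ?H" for e E
  proof -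
    obtain w where w: "e = {w, v}" "w \<noteq> v" "w \<in> verts G"
      using e G by (auto simp: simple_graph_def card_2_iff doubleton_eq_iff)
    have "v \<notin> e'" if "e' \<in> E" for e'
      using E that by (auto simp: delete_vertex_def)
    then have "linked (verts G) (adj_rel (insert e E)) \<longleftrightarrow> linked (verts ?H) (adj_rel E)"
      using w v linked_insert_pendant_edge[of w v "verts G" E] by (simp add: delete_vertex_def)
    moreover have "card (insert e E) = Suc (card E)"
      using e E fin by (intro card_insert_disjoint) (auto simp: delete_vertex_def intro: finite_subset)
    moreover have "insert e E \<subseteq> edges G"
      using e E by (auto simp: delete_vertex_def)
    ultimately show ?thesis
      using E two cardH by (auto simp: spanning_trees_iff[OF G neG] spanning_trees_iff[OF H neH])
  qed
  have "bij_betw ?g (?N \<times> spanning_trees ?H) {T \<in> spanning_trees G. v \<in> leaves T}"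
    unfolding bij_betw_def
  proof (intro conjI)
    show "inj_on ?g (?N \<times> spanning_trees ?H)"
    proof (rule inj_onI)
      fix a b assume "a \<in> ?N \<times> spanning_trees ?H" "b \<in> ?N \<times> spanning_trees ?H" "?g a = ?g b"
      moreover obtain e T e' T' where ab: "a = (e, T)" "b = (e', T')"
        by (metis surj_pair)
      ultimately have e: "v \<in> e" "v \<in> e'" and T: "T \<in> spanning_trees ?H" "T' \<in> spanning_trees ?H"
        and "?g (e, T) = ?g (e', T')"
        by simp_all
      then have eq: "insert e (edges T) = insert e' (edges T')"
        by simp
      have "edges T \<subseteq> edges ?H" "edges T' \<subseteq> edges ?H" and vT: "verts T = verts T'"
        using T by (simp_all add: spanning_trees_iff[OF H neH])
      then have nv: "\<forall>f \<in> edges T. v \<notin> f" "\<forall>f \<in> edges T'. v \<notin> f"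
        by (auto simp: delete_vertex_def)
      then have "e = e'"
        using eq e by blast
      moreover from this have "edges T = edges T'"
        using eq e nv by blast
      ultimately show "a = b"
        using vT ab by (auto intro: ugraph.equality)
    qed
    show "?g ` (?N \<times> spanning_trees ?H) = {T \<in> spanning_trees G. v \<in> leaves T}"
    proof (intro equalityI subsetI)
      fix S assume "S \<in> ?g ` (?N \<times> spanning_trees ?H)"
      then obtain e T where S: "e \<in> ?N" "T \<in> spanning_trees ?H"
          "S = \<lparr>verts = verts G, edges = insert e (edges T)\<rparr>"
        by auto
      have T: "edges T \<subseteq> edges ?H" "verts T = verts ?H"
        using S(2) by (auto simp: spanning_trees_iff[OF H neH])
      then have "T = \<lparr>verts = verts ?H, edges = edges T\<rparr>"
        by simp
      then have "S \<in> spanning_trees G"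
        using tree_iff[OF S(1) T(1)] S by simp
      moreover have "{f \<in> edges S. v \<in> f} = {e}"
        using S(1,3) T by (auto simp: delete_vertex_def)
      ultimately show "S \<in> {T \<in> spanning_trees G. v \<in> leaves T}"
        using v S(3) by (simp add: leaves_def degree_def)
    next
      fix S assume "S \<in> {T \<in> spanning_trees G. v \<in> leaves T}"
      then have S: "S \<in> spanning_trees G" "degree S v = 1"
        by (auto simp: leaves_def)
      have SG: "verts S = verts G" "edges S \<subseteq> edges G"
        using S(1) by (auto simp: spanning_trees_iff[OF G neG])
      obtain e where e: "{f \<in> edges S. v \<in> f} = {e}"
        using S(2) by (auto simp: degree_def card_1_singleton_iff)
      let ?E = "{f \<in> edges S. v \<notin> f}"
      have "e \<in> ?N" "?E \<subseteq> edges ?H"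
        using e SG by (auto simp: delete_vertex_def)
      moreover have "edges S = insert e ?E"
        using e by auto
      then have "S = \<lparr>verts = verts G, edges = insert e ?E\<rparr>"
        using SG by simp
      moreover from this have "\<lparr>verts = verts ?H, edges = ?E\<rparr> \<in> spanning_trees ?H"
        using tree_iff[of e ?E] S(1) calculation by simp
      ultimately show "S \<in> ?g ` (?N \<times> spanning_trees ?H)"
        by (intro image_eqI[of _ _ "(e, \<lparr>verts = verts ?H, edges = ?E\<rparr>)"]) auto
    qed
  qed
  then show ?thesis
    using bij_betw_same_card by (fastforce simp: degree_def num_spanning_trees_def card_cartesian_product)
qed

theorem sum_leaves:
  assumes G: "simple_graph G" and two: "card (verts G) \<ge> 2"
  shows "(\<Sum>T \<in> spanning_trees G. card (leaves T)) =
    (\<Sum>v \<in> verts G. degree G v * num_spanning_trees (delete_vertex G v))"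
proof -
  have "(\<Sum>T \<in> spanning_trees G. card (leaves T)) =
      (\<Sum>T \<in> spanning_trees G. card {v \<in> verts G. v \<in> leaves T})"
    by (intro sum.cong refl arg_cong[where f = card]) (auto simp: leaves_def spanning_trees_def)
  also have "\<dots> = (\<Sum>v \<in> verts G. card {T \<in> spanning_trees G. v \<in> leaves T})"
    using G finite_spanning_trees[OF G] by (intro sum_multicount_gen) (auto simp: simple_graph_def)
  also have "\<dots> = (\<Sum>v \<in> verts G. degree G v * num_spanning_trees (delete_vertex G v))"
    by (intro sum.cong refl card_trees_with_leaf assms)
  finally show ?thesis .
qed

section \<open>The square of a path with some of its ends identified\<close>

text \<open>
  The square of the path through \<open>p\<close>, \<open>q\<close>, \<open>N 0\<close>, ..., \<open>N (m - 1)\<close>, \<open>x\<close>, \<open>y\<close> in this order, except that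
  \<open>p\<close> and \<open>q\<close> are not joined. Thus the case \<open>x = p\<close>, \<open>y = q\<close> is the square of a cycle without a double
  edge: the edge between \<open>p\<close> and \<open>q\<close> is supplied by \<open>x\<close> and \<open>y\<close>. In the pair \<open>(y, N m)\<close> the named
  vertex comes first, because the contraction along a pair keeps its first component.
\<close>

fun squared_path :: "(nat \<Rightarrow> 'a) \<Rightarrow> nat \<Rightarrow> 'a \<Rightarrow> 'a \<Rightarrow> 'a \<Rightarrow> 'a \<Rightarrow> ('a \<times> 'a) list" where
  "squared_path N 0 p q x y = [(p, x), (q, x), (q, y), (x, y)]"
| "squared_path N (Suc m) p q x y = (y, N m) # (x, y) # squared_path N m p q (N m) x"

lemma map_squared_path:
  assumes "\<And>k. k < m \<Longrightarrow> f (N k) = N k"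
  shows "map (map_prod f f) (squared_path N m p q x y) = squared_path N m (f p) (f q) (f x) (f y)"
  using assms by (induction m arbitrary: x y) auto

lemma set_squared_path_subset:
  "set (squared_path N m p q x y) \<subseteq> ({p, q, x, y} \<union> N ` {..<m}) \<times> ({p, q, x, y} \<union> N ` {..<m})"
proof (induction m arbitrary: x y)
  case 0
  then show ?case by auto
next
  case (Suc m)
  let ?A = "{p, q, N m, x} \<union> N ` {..<m}" and ?B = "{p, q, x, y} \<union> N ` {..<Suc m}"
  have "?A \<subseteq> ?B"
    by (auto simp: lessThan_Suc)
  then have "?A \<times> ?A \<subseteq> ?B \<times> ?B"
    by (intro Sigma_mono)
  then have "set (squared_path N m p q (N m) x) \<subseteq> ?B \<times> ?B"
    using Suc[of "N m" x] by (rule order_trans[rotated])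
  moreover have "{(y, N m), (x, y)} \<subseteq> ?B \<times> ?B"
    by simp
  ultimately show ?case by simp
qed

lemma length_squared_path: "length (squared_path N m p q x y) = 2 * m + 4"
  by (induction m arbitrary: x y) auto

lemma edges_squared_path:
  "edge ` set (squared_path (\<lambda>k. w (k + 2)) m (w 0) (w 1) (w (m + 2)) (w (m + 3))) =
    (\<lambda>i. {w i, w (i + 1)}) ` {1..m + 2} \<union> (\<lambda>i. {w i, w (i + 2)}) ` {..m + 1}"
proof (induction m)
  case 0
  have "{1..2::nat} = {1, 2}" "{..1::nat} = {0, 1}" by auto
  then show ?case
    by (auto simp: edge_def numeral_3_eq_3 numeral_2_eq_2)
next
  case (Suc m)
  have w: "w (Suc m + 2) = w (m + 3)" "w (Suc m + 3) = w (m + 4)"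
    "w (m + 3 + 1) = w (m + 4)" "w (m + 2 + 2) = w (m + 4)"
    by (simp_all add: eval_nat_numeral)
  have int: "{1..Suc m + 2} = insert (m + 3) {1..m + 2}" "{..Suc m + 1} = insert (m + 2) {..m + 1}"
    by auto
  have "edge (w (m + 4), w (m + 2)) = {w (m + 2), w (m + 4)}"
    "edge (w (m + 3), w (m + 4)) = {w (m + 3), w (m + 4)}"
    by (auto simp: edge_def)
  then show ?case
    unfolding int image_insert w squared_path.simps list.set Suc.IH
    by (simp only: insert_commute Un_insert_left Un_insert_right)
qed

text \<open>
  The closed form for 25 times the number of spanning trees of a squared path, one case for each way
  in which \<open>p\<close>, \<open>q\<close>, \<open>x\<close>, \<open>y\<close> can coincide. The coefficients are obtained by fitting the first values
  of the 15 sequences; \<open>squared_path_value_0\<close> and \<open>squared_path_value_Suc\<close> show that they are correct.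
  The factor 25 clears the denominators.
\<close>

definition squared_path_value :: "nat \<Rightarrow> 'a \<Rightarrow> 'a \<Rightarrow> 'a \<Rightarrow> 'a \<Rightarrow> int" where
  "squared_path_value m p q x y =
    (let a = int (fib (2 * m)); b = int (fib (2 * m + 1)); t = int m; e = (-1) ^ m in
     if p = q then
       if x = y then
         if x = p then 16*a + 23*b + t * (10*a + 15*b) + 2*e
         else 50*a + 75*b
       else if x = p then 28*a + 44*b + t * (15*a + 25*b) + 6*e
       else if y = p then 48*a + 79*b + t * (15*a + 25*b) - 4*e
       else 75*a + 125*b
     else
       if x = y then
         if x = p then 32*a + 56*b + t * (5*a + 10*b) - 6*e
         else if x = q then 12*a + 21*b + t * (5*a + 10*b) + 4*e
         else 25*a + 50*b
       else if x = p then
         if y = q then 40*a + 70*b + t * (20*a + 35*b) - (20 + 10*t) * e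
         else 56*a + 93*b + t * (10*a + 15*b) - 18*e
       else if x = q then
         if y = p then 30*a + 55*b + t * (20*a + 35*b) + (20 + 10*t) * e
         else 21*a + 38*b + t * (10*a + 15*b) + 12*e
       else if y = p then 71*a + 113*b + t * (10*a + 15*b) + 12*e
       else if y = q then 36*a + 58*b + t * (10*a + 15*b) - 8*e
       else 50*a + 75*b)"

text \<open>
  The recurrence for lengthening the path, where \<open>z\<close> is the new inner vertex next to \<open>x\<close>. The four
  summands belong to the choices for the new edges \<open>(y, z)\<close> and \<open>(x, y)\<close>: deleting both, which
  isolates \<open>y\<close> unless it is one of the other named vertices; contracting only \<open>(x, y)\<close>; contracting
  only \<open>(y, z)\<close>; contracting both. An edge \<open>(x, y)\<close> that is a loop cannot be contracted.
\<close>

lemma squared_path_value_Suc: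
  fixes p q x y z :: 'a
  assumes "z \<notin> {p, q, x, y}"
  defines "c \<equiv> contract x y"
  shows "squared_path_value (Suc m) p q x y =
    (if y \<in> {p, q, x} then squared_path_value m p q z x else 0) +
    (if x = y then 0 else squared_path_value m (c p) (c q) z x) +
    squared_path_value m p q y x +
    (if x = y then 0 else squared_path_value m (c p) (c q) x x)"
proof -
  define a b e where ab: "a = int (fib (2 * m))" "b = int (fib (2 * m + 1))" "e = (-1 :: int) ^ m"
  have rec: "int (fib (2 * Suc m)) = a + b" "int (fib (2 * Suc m + 1)) = a + 2 * b" "(-1) ^ Suc m = - e"
    by (simp_all add: ab)
  have z: "z \<noteq> p" "z \<noteq> q" "z \<noteq> x" "z \<noteq> y" "p \<noteq> z" "q \<noteq> z" "x \<noteq> z" "y \<noteq> z" using assms by auto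
  show ?thesis
    unfolding squared_path_value_def rec Let_def ab[symmetric] c_def contract_def
    using z
    by (cases "p = q"; cases "x = y"; cases "p = x"; cases "p = y"; cases "q = x"; cases "q = y")
      (simp_all add: algebra_simps)
qed

lemma squared_path_value_0:
  "int (25 * tree_count (card {p, q, x, y}) (squared_path N 0 p q x y)) =
    squared_path_value 0 p q x y"
  by (cases "p = q"; cases "x = y"; cases "p = x"; cases "p = y"; cases "q = x"; cases "q = y";
      simp add: contract_def squared_path_value_def card_insert_if)

text \<open>
  The names \<open>p\<close>, \<open>q\<close>, \<open>x\<close>, \<open>y\<close> are arbitrary, so the induction runs over all identifications at once
  and a contraction among the named vertices is just another instance of the same statement.
\<close>

theorem tree_count_squared_path:
  assumes "inj_on N {..<m}" "{p, q, x, y} \<inter> N ` {..<m} = {}"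
  shows "int (25 * tree_count (card {p, q, x, y} + m) (squared_path N m p q x y)) = squared_path_value m p q x y"
  using assms
proof (induction m arbitrary: p q x y)
  case 0
  show ?case using squared_path_value_0[of p q x y N] by (simp only: add_0_right)
next
  case (Suc m)
  define z where "z = N m"
  define c where "c = contract x y"
  define k where "k = card {p, q, x, y}"
  have inj: "inj_on N {..<m}" and zN: "z \<notin> N ` {..<m}"
    using Suc.prems(1) by (auto simp: z_def lessThan_Suc)
  have dis: "{p, q, x, y} \<inter> N ` {..<m} = {}" and z: "z \<notin> {p, q, x, y}"
    using Suc.prems(2) by (auto simp: z_def lessThan_Suc)
  have k: "k \<ge> 1" unfolding k_def by (simp add: card_insert_if)
  have m1: "map (map_prod (contract y z) (contract y z)) (squared_path N m p q z x) = squared_path N m p q y x"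
    using z zN by (subst map_squared_path) (auto simp: contract_def)
  have m2: "map (map_prod c c) (squared_path N m p q z x) = squared_path N m (c p) (c q) z x"
    using z dis by (subst map_squared_path) (auto simp: contract_def c_def)
  have m3: "map (map_prod c c) (squared_path N m p q y x) = squared_path N m (c p) (c q) x x" 
    using dis by (subst map_squared_path) (auto simp: contract_def c_def)
  have split: "tree_count (k + Suc m) (squared_path N (Suc m) p q x y) =
      tree_count (k + Suc m) (squared_path N m p q z x) +
      (if x = y then 0 else tree_count (k + m) (squared_path N m (c p) (c q) z x)) +
      tree_count (k + m) (squared_path N m p q y x) +
      (if x = y then 0 else tree_count (k + m - 1) (squared_path N m (c p) (c q) x x))"
  proof -
    have c: "contract y z x = x" "contract y z y = y" and "y \<noteq> z"
      using z by (auto simp: contract_def)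
    have "k + Suc m - 1 = k + m"
      by simp
    then show ?thesis
      unfolding squared_path.simps(2) tree_count.simps(2) list.map map_prod_simp z_def[symmetric]
        c m1 m2 m3 c_def[symmetric] if_not_P[OF \<open>y \<noteq> z\<close>]
      by (simp only: add.assoc)
  qed
  have t1: "int (25 * tree_count (k + Suc m) (squared_path N m p q z x)) =
      (if y \<in> {p, q, x} then squared_path_value m p q z x else 0)"
  proof (cases "y \<in> {p, q, x}")
    case True
    then have "card {p, q, z, x} = Suc k"
      using z by (auto simp: k_def card_insert_if)
    then show ?thesis
      using Suc.IH[of p q z x] inj dis zN True by (simp only: if_True) simp
  next
    case False
    then have "card {p, q, z, x} = k"
      using z by (auto simp: k_def card_insert_if)
    moreover have "card ({p, q, z, x} \<union> N ` {..<m}) \<le> card {p, q, z, x} + m"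
      using card_Un_le[of "{p, q, z, x}" "N ` {..<m}"] card_image_le[of "{..<m}" N] by simp
    ultimately show ?thesis
      using False set_squared_path_subset[of N m p q z x] k
      by (subst tree_count_too_few_vertices[of "{p, q, z, x} \<union> N ` {..<m}"]) auto
  qed
  have t2: "int (25 * tree_count (k + m) (squared_path N m (c p) (c q) z x)) = squared_path_value m (c p) (c q) z x"
    if "x \<noteq> y"
  proof -
    have "card {c p, c q, z, x} = k"
      using z that by (auto simp: k_def card_insert_if c_def contract_def)
    moreover have "{c p, c q, z, x} \<inter> N ` {..<m} = {}"
      using dis zN by (auto simp: c_def contract_def)
    ultimately show ?thesis
      using Suc.IH[of "c p" "c q" z x] inj by simp
  qed
  have t3: "int (25 * tree_count (k + m) (squared_path N m p q y x)) = squared_path_value m p q y x"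
    using Suc.IH[of p q y x] inj dis by (simp add: k_def insert_commute)
  have t4: "int (25 * tree_count (k + m - 1) (squared_path N m (c p) (c q) x x)) = squared_path_value m (c p) (c q) x x"
    if "x \<noteq> y"
  proof -
    have "k = Suc (card {c p, c q, x, x})"
      using that by (auto simp: k_def card_insert_if c_def contract_def)
    moreover have "{c p, c q, x, x} \<inter> N ` {..<m} = {}"
      using dis by (auto simp: c_def contract_def)
    ultimately show ?thesis
      using Suc.IH[of "c p" "c q" x x] inj by simp
  qed
  show ?case
    unfolding k_def[symmetric] split squared_path_value_Suc[OF z] c_def[symmetric]
    using t1 t2 t3 t4 by (simp add: algebra_simps)
qed

text \<open>
  The edge \<open>(p, q)\<close> is the one that the squared path lacks, and \<open>(p, y)\<close> joins its ends. This is
  the square of a cycle on \<open>m + 5\<close> vertices after the removal of one vertex. The formula adds up the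
  four closed forms for the deletion or contraction of the two edges.
\<close>

lemma tree_count_squared_path_with_two_chords:
  assumes "distinct [p, q, x, y]" "inj_on N {..<m}" "{p, q, x, y} \<inter> N ` {..<m} = {}"
  shows "int (25 * tree_count (m + 4) ((p, q) # (p, y) # squared_path N m p q x y)) =
    int m * (25 * int (fib (2 * m)) + 40 * int (fib (2 * m + 1))) +
    244 * int (fib (2 * m)) + 392 * int (fib (2 * m + 1)) + 8 * (- 1) ^ m"
proof -
  have d: "p \<noteq> q" "p \<noteq> x" "p \<noteq> y" "q \<noteq> x" "q \<noteq> y" "x \<noteq> y"
    using assms(1) by auto
  have c: "contract p q p = p" "contract p q y = y" "contract p q q = p" "contract p q x = x"
    "contract p y p = p" "contract p y y = p" "contract p y q = q" "contract p y x = x"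
    using d by (auto simp: contract_def)
  have q: "map (map_prod (contract p q) (contract p q)) (squared_path N m p' q' x' y') =
      squared_path N m (contract p q p') (contract p q q') (contract p q x') (contract p q y')" for p' q' x' y'
    using assms(3) by (intro map_squared_path) (auto simp: contract_def)
  have y: "map (map_prod (contract p y) (contract p y)) (squared_path N m p' q' x' y') =
      squared_path N m (contract p y p') (contract p y q') (contract p y x') (contract p y y')" for p' q' x' y'
    using assms(3) by (intro map_squared_path) (auto simp: contract_def)
  have n: "m + 4 - 1 = m + 3" "m + 3 - 1 = m + 2"
    by simp_all
  have "tree_count (m + 4) ((p, q) # (p, y) # squared_path N m p q x y) =
      tree_count (m + 4) (squared_path N m p q x y) + tree_count (m + 3) (squared_path N m p q x p) +
      (tree_count (m + 3) (squared_path N m p p x y) + tree_count (m + 2) (squared_path N m p p x p))"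
    unfolding tree_count.simps(2) list.map map_prod_simp q y c n if_not_P[OF d(1)] if_not_P[OF d(3)]
    by (rule refl)
  moreover have "int (25 * tree_count (m + 4) (squared_path N m p q x y)) = squared_path_value m p q x y"
    "int (25 * tree_count (m + 3) (squared_path N m p q x p)) = squared_path_value m p q x p"
    "int (25 * tree_count (m + 3) (squared_path N m p p x y)) = squared_path_value m p p x y"
    "int (25 * tree_count (m + 2) (squared_path N m p p x p)) = squared_path_value m p p x p"
  proof -
    have "card {p, q, x, y} = 4" "card {p, q, x, p} = 3" "card {p, p, x, y} = 3" "card {p, p, x, p} = 2"
      using d by (auto simp: card_insert_if)
    then show "int (25 * tree_count (m + 4) (squared_path N m p q x y)) = squared_path_value m p q x y"
      "int (25 * tree_count (m + 3) (squared_path N m p q x p)) = squared_path_value m p q x p"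
      "int (25 * tree_count (m + 3) (squared_path N m p p x y)) = squared_path_value m p p x y"
      "int (25 * tree_count (m + 2) (squared_path N m p p x p)) = squared_path_value m p p x p"
      using tree_count_squared_path[OF assms(2), of p q x y] tree_count_squared_path[OF assms(2), of p q x p]
        tree_count_squared_path[OF assms(2), of p p x y] tree_count_squared_path[OF assms(2), of p p x p] assms(3)
      by (simp_all add: add.commute[of m])
  qed
  ultimately have "int (25 * tree_count (m + 4) ((p, q) # (p, y) # squared_path N m p q x y)) =
      squared_path_value m p q x y + squared_path_value m p q x p +
      squared_path_value m p p x y + squared_path_value m p p x p"
    by simp
  also have "\<dots> = int m * (25 * int (fib (2 * m)) + 40 * int (fib (2 * m + 1))) +
      244 * int (fib (2 * m)) + 392 * int (fib (2 * m + 1)) + 8 * (- 1) ^ m"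
    using d by (simp add: squared_path_value_def Let_def algebra_simps)
  finally show ?thesis .
qed

section \<open>The square of a cycle\<close>

text \<open>
  The vertices of the cycle, numbered from \<open>s\<close> onwards; indices beyond \<open>n\<close> wrap around. Numbering
  from the vertex after \<open>v\<close> makes the deletion of \<open>v\<close> the same computation for every \<open>v\<close>.
\<close>

definition rot :: "nat \<Rightarrow> nat \<Rightarrow> nat \<Rightarrow> nat" where
  "rot n s j = (s + j) mod n"

lemma rot_eq_iff: "rot n s i = rot n s j \<longleftrightarrow> i mod n = j mod n"
  unfolding rot_def using cong_add_lcancel_nat[of s i j n] by (simp add: cong_def)

lemma rot_lessThan:
  assumes "0 < n"
  shows "rot n s ` {..<n} = {..<n}"
proof (rule card_subset_eq)
  have "inj_on (rot n s) {..<n}"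
    by (auto simp: inj_on_def rot_eq_iff)
  then show "card (rot n s ` {..<n}) = card {..<n}"
    by (rule card_image)
qed (use assms in \<open>auto simp: rot_def\<close>)

lemma adjacent_cycle_graph:
  assumes "u < n" "v < n"
  shows "adjacent (cycle_graph n) u v \<longleftrightarrow> v = (u + 1) mod n \<or> u = (v + 1) mod n"
  using assms by (auto simp: adjacent_def cycle_graph_def doubleton_eq_iff)

lemma graph_dist_le_iff:
  "graph_dist G u v \<le> enat k \<longleftrightarrow> (\<exists>p. path_between G u p v \<and> length p \<le> k + 1)"
proof
  assume le: "graph_dist G u v \<le> enat k"
  show "\<exists>p. path_between G u p v \<and> length p \<le> k + 1"
  proof (rule ccontr)
    assume "\<nexists>p. path_between G u p v \<and> length p \<le> k + 1"
    then have "enat (Suc k) \<le> graph_dist G u v"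
      unfolding graph_dist_def by (intro INF_greatest) auto
    with le have "enat (Suc k) \<le> enat k"
      by (rule order_trans[rotated])
    then show False by simp
  qed
next
  assume "\<exists>p. path_between G u p v \<and> length p \<le> k + 1"
  then obtain p where p: "path_between G u p v" "length p \<le> k + 1" by blast
  then have "graph_dist G u v \<le> enat (length p - 1)"
    unfolding graph_dist_def by (intro INF_lower) simp
  also have "\<dots> \<le> enat k"
    using p by simp
  finally show "graph_dist G u v \<le> enat k" .
qed

lemma one_le_graph_dist_iff:
  assumes "v \<in> verts G"
  shows "1 \<le> graph_dist G u v \<longleftrightarrow> u \<noteq> v"
proof
  assume "u \<noteq> v"
  show "1 \<le> graph_dist G u v"
  proof (rule ccontr)
    assume "\<not> 1 \<le> graph_dist G u v"
    then have "graph_dist G u v = 0"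
      by (metis iless_eSuc0 not_le one_eSuc)
    then have "graph_dist G u v \<le> enat 0"
      by (simp add: zero_enat_def)
    then obtain p where "path_between G u p v" "length p \<le> 1"
      unfolding graph_dist_le_iff by auto
    then show False
      using \<open>u \<noteq> v\<close> by (cases p) (auto simp: path_between_def)
  qed
qed (use assms graph_dist_self[of v G] in auto)

lemma edges_graph_power_2:
  "edges (graph_power G 2) = {{u, v} | u v. u \<in> verts G \<and> v \<in> verts G \<and> u \<noteq> v \<and>
     (adjacent G u v \<or> (\<exists>w \<in> verts G. w \<noteq> u \<and> w \<noteq> v \<and> adjacent G u w \<and> adjacent G w v))}"
proof -
  have "1 \<le> graph_dist G u v \<and> graph_dist G u v \<le> enat 2 \<longleftrightarrow> u \<noteq> v \<and>
     (adjacent G u v \<or> (\<exists>w \<in> verts G. w \<noteq> u \<and> w \<noteq> v \<and> adjacent G u w \<and> adjacent G w v))"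
    if uv: "u \<in> verts G" "v \<in> verts G" for u v
  proof (cases "u = v")
    case False
    have "(\<exists>p. path_between G u p v \<and> length p \<le> 2 + 1) \<longleftrightarrow>
        adjacent G u v \<or> (\<exists>w \<in> verts G. w \<noteq> u \<and> w \<noteq> v \<and> adjacent G u w \<and> adjacent G w v)"
      (is "?L \<longleftrightarrow> ?R")
    proof
      assume ?L
      then obtain p where p: "path_between G u p v" "length p \<le> 3" by auto
      then consider "length p = 0" | "length p = 1" | "length p = 2" | "length p = 3"
        by linarith
      then show ?R
      proof cases
        case 3
        then obtain a b where "p = [a, b]"
          by (auto simp: numeral_2_eq_2 length_Suc_conv)
        then show ?R
          using p by (auto simp: path_between_def)
      next
        case 4
        then obtain a w b where "p = [a, w, b]"
          by (auto simp: numeral_3_eq_3 length_Suc_conv)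
        moreover have "\<forall>i. Suc i < length p \<longrightarrow> adjacent G (p ! i) (p ! Suc i)"
          using p by (simp add: path_between_def)
        from this[THEN spec, of 0] this[THEN spec, of 1] have "adjacent G a w" "adjacent G w b"
          using \<open>p = [a, w, b]\<close> by simp_all
        ultimately have "w \<in> verts G" "w \<noteq> u" "w \<noteq> v" "adjacent G u w" "adjacent G w v"
          using p by (auto simp: path_between_def)
        then show ?R by blast
      qed (use p False in \<open>auto simp: path_between_def length_Suc_conv\<close>)
    next
      assume ?R
      then consider "adjacent G u v" | w where "w \<in> verts G" "w \<noteq> u" "w \<noteq> v" "adjacent G u w" "adjacent G w v"
        by blast
      then show ?L
      proof cases
        case 1
        then have "path_between G u [u, v] v"
          using uv False by (simp add: path_between_def)
        then show ?thesis
          by (intro exI[of _ "[u, v]"]) simp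
      next
        case (2 w)
        then have "path_between G u [u, w, v] v"
          using uv False by (auto simp: path_between_def less_Suc_eq nth_Cons')
        then show ?thesis
          by (intro exI[of _ "[u, w, v]"]) simp
      qed
    qed
    then show ?thesis
      using uv False by (simp add: graph_dist_le_iff one_le_graph_dist_iff)
  qed (use uv one_le_graph_dist_iff[of v G u] in simp)
  then have "u \<in> verts G \<and> v \<in> verts G \<and> 1 \<le> graph_dist G u v \<and> graph_dist G u v \<le> enat 2 \<longleftrightarrow>
      u \<in> verts G \<and> v \<in> verts G \<and> u \<noteq> v \<and>
     (adjacent G u v \<or> (\<exists>w \<in> verts G. w \<noteq> u \<and> w \<noteq> v \<and> adjacent G u w \<and> adjacent G w v))" for u v
    by metis
  then show ?thesis
    unfolding graph_power_def by (simp only: ugraph.select_convs)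
qed

lemma squared_cycles_edges:
  assumes "n \<ge> 5"
  shows "edges (squared_cycles n) = (\<lambda>(j, d). {rot n s j, rot n s (j + d)}) ` ({..<n} \<times> {1, 2})"
proof -
  have suc: "Suc u mod n = (if Suc u = n then 0 else Suc u)" 
    "Suc (Suc u) mod n = (if Suc u = n then 1 else if Suc (Suc u) = n then 0 else Suc (Suc u))" if "u < n" for u
    using that assms by (auto simp: mod_if)
  let ?w = "\<lambda>i::nat. (i + 1) mod n"
  have step: "?w i < n" "?w i \<noteq> i" "?w (?w i) \<noteq> i" "?w (?w i) = (i + 2) mod n" if "i < n" for i
    using that assms by (auto simp: suc)
  have "edges (squared_cycles n) = {{u, v} | u v. u < n \<and> v < n \<and> u \<noteq> v \<and>
     (adjacent (cycle_graph n) u v \<or> (\<exists>w < n. w \<noteq> u \<and> w \<noteq> v \<and> adjacent (cycle_graph n) u w \<and>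
        adjacent (cycle_graph n) w v))}"
    unfolding squared_cycles_def edges_graph_power_2 by (simp add: cycle_graph_def Bex_def)
  also have "\<dots> = (\<lambda>(i, d). {i, (i + d) mod n}) ` ({..<n} \<times> {1, 2})" (is "?L = ?R")
  proof (intro equalityI subsetI)
    fix e assume "e \<in> ?L"
    then obtain u v where uv: "e = {u, v}" "u < n" "v < n" "u \<noteq> v"
      "adjacent (cycle_graph n) u v \<or> (\<exists>w < n. w \<noteq> u \<and> w \<noteq> v \<and> adjacent (cycle_graph n) u w \<and>
        adjacent (cycle_graph n) w v)"
      by blast
    have "v = ?w u \<or> u = ?w v \<or> v = (u + 2) mod n \<or> u = (v + 2) mod n"
      using uv(5)
    proof (elim disjE exE conjE)
      fix w assume w: "w < n" "w \<noteq> u" "w \<noteq> v" "adjacent (cycle_graph n) u w" "adjacent (cycle_graph n) w v"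
      then show ?thesis
        using uv(2-4) by (auto simp: adjacent_cycle_graph suc split: if_splits)
    qed (use uv in \<open>auto simp: adjacent_cycle_graph\<close>)
    then obtain i d where "e = {i, (i + d) mod n}" "i < n" "d \<in> {1, 2}"
      using uv(1-3) by (metis insertCI insert_commute)
    then show "e \<in> ?R" by (auto intro!: image_eqI[of _ _ "(i, d)"])
  next
    fix e assume "e \<in> ?R"
    then obtain i d where e: "e = {i, (i + d) mod n}" "i < n" "d = 1 \<or> d = 2"
      by auto
    have "adjacent (cycle_graph n) i (?w i)" "adjacent (cycle_graph n) (?w i) (?w (?w i))"
      using e(2) step[OF e(2)] by (simp_all add: adjacent_cycle_graph)
    moreover have "?w (?w i) < n" "?w (?w i) \<noteq> ?w i"
      using step[of "?w i"] step[OF e(2)] by simp_all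
    moreover have "(i + d) mod n = ?w i \<or> (i + d) mod n = ?w (?w i)"
      using e(3) step(4)[OF e(2)] by auto
    ultimately have "(i + d) mod n < n" "i \<noteq> (i + d) mod n" "adjacent (cycle_graph n) i ((i + d) mod n) \<or>
        (\<exists>w < n. w \<noteq> i \<and> w \<noteq> (i + d) mod n \<and> adjacent (cycle_graph n) i w \<and>
          adjacent (cycle_graph n) w ((i + d) mod n))"
      using step[OF e(2)] by metis+
    then show "e \<in> ?L"
      using e(1,2) by blast
  qed
  also have "\<dots> = (\<lambda>(i, d). {i, (i + d) mod n}) ` (rot n s ` {..<n} \<times> {1, 2})"
    using assms by (simp add: rot_lessThan)
  also have "rot n s ` {..<n} \<times> {1, 2} = map_prod (rot n s) id ` ({..<n} \<times> {1, 2::nat})"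
    by (force simp: image_iff)
  also have "(\<lambda>(i, d). {i, (i + d) mod n}) ` map_prod (rot n s) id ` ({..<n} \<times> {1, 2}) =
      (\<lambda>(j, d). {rot n s j, rot n s (j + d)}) ` ({..<n} \<times> {1, 2})"
    unfolding image_image by (intro image_cong) (auto simp: rot_def mod_simps add.assoc)
  finally show ?thesis .
qed

lemma add_mod_small:
  fixes j d n :: nat
  assumes "j < n" "d \<le> 2" "n \<ge> 5"
  shows "(j + d) mod n = (if j + d < n then j + d else j + d - n)"
  using assms by (auto simp: mod_if)

text \<open>
  For \<open>n = 4\<close> this fails, as opposite vertices are then at distance 2 in both directions.
\<close>

lemma inj_on_chords:
  assumes "n \<ge> 5"
  shows "inj_on (\<lambda>(j, d). {rot n s j, rot n s (j + d)}) ({..<n} \<times> {1, 2})"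
proof (rule inj_onI)
  fix a b assume ab: "a \<in> {..<n} \<times> {1, 2::nat}" "b \<in> {..<n} \<times> {1, 2::nat}"
    "(case a of (j, d) \<Rightarrow> {rot n s j, rot n s (j + d)}) = (case b of (j, d) \<Rightarrow> {rot n s j, rot n s (j + d)})"
  obtain j d k c where jk: "a = (j, d)" "b = (k, c)"
    by (metis surj_pair)
  with ab have d: "d = 1 \<or> d = 2" "c = 1 \<or> c = 2" and j: "j < n" "k < n"
    and eq: "{rot n s j, rot n s (j + d)} = {rot n s k, rot n s (k + c)}"
    by auto
  have *: "d \<le> 2" "c \<le> 2" using d by auto
  from eq have "j = k \<and> d = c"
    unfolding doubleton_eq_iff rot_eq_iff add_mod_small[OF j(1) *(1) assms] add_mod_small[OF j(2) *(2) assms]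
    using d j assms by (auto split: if_splits)
  with jk show "a = b" by simp
qed

lemma rot_in_chord_iff:
  assumes "n \<ge> 5" "i < n" "j < n" "d \<in> {1, 2}"
  shows "rot n s i \<in> {rot n s j, rot n s (j + d)} \<longleftrightarrow> j = i \<or> j + d = i \<or> j + d = i + n"
proof -
  have "d \<le> 2"
    using assms(4) by auto
  then show ?thesis
    using assms by (auto simp: rot_eq_iff add_mod_small)
qed

lemma card_edges_squared_cycles:
  assumes "n \<ge> 5"
  shows "card (edges (squared_cycles n)) = 2 * n"
  unfolding squared_cycles_edges[OF assms, of 0] card_image[OF inj_on_chords[OF assms]]
  by (simp add: card_cartesian_product)

lemma degree_squared_cycles:
  assumes "n \<ge> 5" "v < n"
  shows "degree (squared_cycles n) v = 4"
proof -
  let ?f = "\<lambda>(j, d). {rot n v j, rot n v (j + d)}"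
  let ?A = "{(0, 1), (0, 2), (n - 1, 1), (n - 2, 2)} :: (nat \<times> nat) set"
  have v: "v = rot n v 0"
    using assms by (simp add: rot_def)
  have "{e \<in> edges (squared_cycles n). v \<in> e} = ?f ` {x \<in> {..<n} \<times> {1, 2}. v \<in> ?f x}"
    unfolding squared_cycles_edges[OF assms(1), of v] by blast
  also have "{x \<in> {..<n} \<times> {1, 2}. v \<in> ?f x} = {(j, d) \<in> {..<n} \<times> {1, 2}. j = 0 \<or> j + d = n}"
  proof -
    have "v \<in> ?f (j, d) \<longleftrightarrow> j = 0 \<or> j + d = n" if "j < n" "d \<in> {1, 2}" for j d
      using rot_in_chord_iff[of n 0 j d v] that assms(1) by (simp flip: v) auto
    then show ?thesis by blast
  qed
  also have "\<dots> = ?A"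
    using assms(1) by auto
  finally have "degree (squared_cycles n) v = card (?f ` ?A)"
    by (simp add: degree_def)
  also have "\<dots> = card ?A"
    using assms(1) by (intro card_image inj_on_subset[OF inj_on_chords[OF assms(1)]]) auto
  also have "\<dots> = 4"
    using assms(1) by (simp add: card_insert_if) 
  finally show ?thesis .
qed

lemma simple_squared_cycles: "simple_graph (squared_cycles n)"
  unfolding squared_cycles_def by (rule simple_graph_graph_power) (simp add: cycle_graph_def)

lemma verts_squared_cycles: "verts (squared_cycles n) = {..<n}"
  by (simp add: squared_cycles_def graph_power_def cycle_graph_def)

text \<open>
  The path runs once around the cycle, so that its last two vertices are the first two again.
\<close>

theorem num_spanning_trees_squared_cycle:
  assumes "n \<ge> 5"
  defines "m \<equiv> n - 2"
  shows "int (25 * num_spanning_trees (squared_cycles n)) =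
    40 * int (fib (2 * m)) + 70 * int (fib (2 * m + 1)) +
    int m * (20 * int (fib (2 * m)) + 35 * int (fib (2 * m + 1))) - (20 + 10 * int m) * (- 1) ^ m"
proof -
  let ?w = "rot n 0"
  let ?N = "\<lambda>k. ?w (k + 2)"
  define es where "es = squared_path ?N m (?w 0) (?w 1) (?w (m + 2)) (?w (m + 3))"
  have w: "?w 0 = 0" "?w 1 = 1" "?w (m + 2) = 0" "?w (m + 3) = 1"
    using assms by (auto simp: rot_def mod_if)
  have "edge ` set es = (\<lambda>i. {?w i, ?w (i + 1)}) ` {1..n} \<union> (\<lambda>i. {?w i, ?w (i + 2)}) ` {..<n}"
  proof -
    have "m + 2 = n" "{..m + 1} = {..<n}"
      using assms by auto
    then show ?thesis
      unfolding es_def edges_squared_path by simp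
  qed
  also have "(\<lambda>i. {?w i, ?w (i + 1)}) ` {1..n} = (\<lambda>i. {?w i, ?w (i + 1)}) ` {..<n}"
  proof -
    have "{1..n} = insert n {1..<n}" "{..<n} = insert 0 {1..<n}"
      using assms by auto
    moreover have "?w n = ?w 0"
      by (simp add: rot_def)
    moreover have "?w (n + 1) = ?w (0 + 1)"
      unfolding rot_eq_iff add_0 by (rule mod_add_self1)
    ultimately show ?thesis
      by (simp only: image_insert)
  qed
  also have "\<dots> \<union> (\<lambda>i. {?w i, ?w (i + 2)}) ` {..<n} = edges (squared_cycles n)"
  proof -
    have "{..<n} \<times> {1, 2::nat} = (\<lambda>j. (j, 1)) ` {..<n} \<union> (\<lambda>j. (j, 2)) ` {..<n}"
      by auto
    then show ?thesis
      unfolding squared_cycles_edges[OF assms(1), of 0] by (simp only: image_Un image_image prod.case)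
  qed
  finally have edges: "edge ` set es = edges (squared_cycles n)" .
  have "card (set (map edge es)) = length (map edge es)"
    using card_edges_squared_cycles[OF assms(1)] assms edges by (simp add: es_def length_squared_path)
  \<comment> \<open>The list is as long as the set of edges that it covers, so it contains no edge twice.\<close>
  then have dist: "distinct (map edge es)"
    by (rule card_distinct)
  have "num_spanning_trees (squared_cycles n) = tree_count n es"
    using num_spanning_trees_eq_tree_count[OF simple_squared_cycles _ dist edges] assms
    by (simp add: verts_squared_cycles lessThan_empty_iff)
  also have "int (25 * \<dots>) = squared_path_value m 0 1 0 (1::nat)"
  proof -
    have "inj_on ?N {..<m}" "{0, 1, 0, 1} \<inter> ?N ` {..<m} = {}"
      using assms by (auto simp: inj_on_def rot_def)
    moreover have "card {0, 1, 0, 1::nat} + m = n"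
      using assms by (simp add: card_insert_if)
    ultimately show ?thesis
      using tree_count_squared_path[of ?N m 0 1 0 1] unfolding es_def w by (simp only:)
  qed
  finally show ?thesis
    by (simp add: squared_path_value_def Let_def)
qed

text \<open>
  The path runs through the vertices after \<open>v\<close> up to the one before \<open>v\<close>. Besides its squared edges
  there remains the edge between the two neighbours of \<open>v\<close> on the cycle.
\<close>

theorem num_spanning_trees_delete_vertex:
  assumes "n \<ge> 5" "v < n"
  defines "m \<equiv> n - 5"
  shows "int (25 * num_spanning_trees (delete_vertex (squared_cycles n) v)) =
    int m * (25 * int (fib (2 * m)) + 40 * int (fib (2 * m + 1))) +
    244 * int (fib (2 * m)) + 392 * int (fib (2 * m + 1)) + 8 * (- 1) ^ m"
proof -
  let ?G = "delete_vertex (squared_cycles n) v"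
  define s where "s = v + 1"
  let ?w = "rot n s"
  let ?N = "\<lambda>k. ?w (k + 2)"
  define ch where "ch = squared_path ?N m (?w 0) (?w 1) (?w (m + 2)) (?w (m + 3))"
  define es where "es = (?w 0, ?w 1) # (?w 0, ?w (m + 3)) # ch"
  have v: "v = ?w (n - 1)"
    using assms by (simp add: rot_def s_def)
  have n: "m + 2 = n - 3" "m + 3 = n - 2" "m + 1 = n - 4" and mn: "m + 5 = n"
    using assms by auto
  let ?f = "\<lambda>(j, d). {?w j, ?w (j + d)}"
  have "edges ?G = ?f ` {x \<in> {..<n} \<times> {1, 2}. v \<notin> ?f x}"
    unfolding delete_vertex_def squared_cycles_edges[OF assms(1), of s] by auto
  also have "{x \<in> {..<n} \<times> {1, 2}. v \<notin> ?f x} =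
      (\<lambda>j. (j, 1)) ` {..n - 3} \<union> (\<lambda>j. (j, 2)) ` {..n - 4} \<union> {(n - 2, 2)}"
    (is "?X = ?Y")
  proof -
    have "?X = {(j, d) \<in> {..<n} \<times> {1, 2}. j \<noteq> n - 1 \<and> j + d \<noteq> n - 1}"
    proof -
      have "v \<in> ?f (j, d) \<longleftrightarrow> j = n - 1 \<or> j + d = n - 1" if "j < n" "d \<in> {1, 2}" for j d
        using rot_in_chord_iff[of n "n - 1" j d s, folded v] that assms(1) by auto
      then show ?thesis by blast
    qed
    also have "\<dots> = ?Y"
      using assms(1) by auto
    finally show ?thesis .
  qed
  also have "?f ` \<dots> = edge ` set es"
  proof -
    have "{..n - 3} = insert 0 {1..n - 3}"
      by auto
    moreover have "n - 2 + 2 = n"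
      using assms by simp
    then have "?w (n - 2 + 2) = ?w 0"
      by (simp only: rot_eq_iff mod_self mod_0)
    ultimately show ?thesis
      unfolding es_def list.set image_insert edges_squared_path[of ?w m, folded ch_def] n
      by (simp add: image_Un image_image edge_def insert_commute Un_ac)
  qed
  finally have edges: "edge ` set es = edges ?G" by simp
  have fin: "finite (edges (squared_cycles n))"
    using card_edges_squared_cycles[OF assms(1)] assms(1) by (intro card_ge_0_finite) simp
  have "edges ?G = edges (squared_cycles n) - {e \<in> edges (squared_cycles n). v \<in> e}"
    by (auto simp: delete_vertex_def)
  then have "card (edges ?G) = 2 * n - 4"
    using degree_squared_cycles[OF assms(1,2)] card_edges_squared_cycles[OF assms(1)] fin
    by (simp add: card_Diff_subset degree_def)
  then have "card (set (map edge es)) = length (map edge es)"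
    using edges mn by (simp add: es_def ch_def length_squared_path)
  then have dist: "distinct (map edge es)"
    by (rule card_distinct)
  have V: "verts ?G = {..<n} - {v}"
    by (simp add: delete_vertex_def verts_squared_cycles)
  have simple: "simple_graph ?G"
    using simple_squared_cycles[of n] by (auto simp: simple_graph_def delete_vertex_def)
  have card: "card (verts ?G) = m + 4"
    using assms by (simp add: V)
  then have "verts ?G \<noteq> {}"
    by auto
  then have "num_spanning_trees ?G = tree_count (m + 4) es"
    using num_spanning_trees_eq_tree_count[OF simple _ dist edges] card by simp
  also have "int (25 * \<dots>) = int m * (25 * int (fib (2 * m)) + 40 * int (fib (2 * m + 1))) +
    244 * int (fib (2 * m)) + 392 * int (fib (2 * m + 1)) + 8 * (- 1) ^ m"
    unfolding es_def ch_def
  proof (rule tree_count_squared_path_with_two_chords)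
    have small: "?w i = ?w j \<longleftrightarrow> i = j" if "i < m + 5" "j < m + 5" for i j
      using that mn by (simp add: rot_eq_iff)
    show "distinct [?w 0, ?w 1, ?w (m + 2), ?w (m + 3)]"
      by (simp add: small)
    show "inj_on (\<lambda>k. ?w (k + 2)) {..<m}"
      by (simp add: inj_on_def small)
    show "{?w 0, ?w 1, ?w (m + 2), ?w (m + 3)} \<inter> (\<lambda>k. ?w (k + 2)) ` {..<m} = {}"
      by (auto simp: small)
  qed
  finally show ?thesis .
qed

section \<open>The limit\<close>

lemma fib_odd_gt: "n < fib (2 * n + 1)"
proof (induction n)
  case (Suc n)
  have "fib (2 * Suc n + 1) = fib (2 * n + 1) + fib (2 * n + 2)"
    by simp
  moreover have "fib (2 * n + 2) > 0"
    by (rule fib_neq_0_nat) simp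
  ultimately show ?case
    using Suc by linarith
qed simp

lemma fib_even_odd_ratio:
  "(\<lambda>m. real (fib (2 * m)) / real (fib (2 * m + 1))) \<longlonglongrightarrow> (sqrt 5 - 1) / 2"
proof -
  define \<phi> :: real where "\<phi> = (1 + sqrt 5) / 2"
  let ?u = "\<lambda>n. real (fib n) / (\<phi> ^ n / sqrt 5)"
  have pos: "\<phi> > 0"
    by (simp add: \<phi>_def add_pos_nonneg)
  have lim: "?u \<longlonglongrightarrow> 1"
    unfolding \<phi>_def by (rule fib_asymptotics)
  have "(\<lambda>m. ?u (2 * m)) \<longlonglongrightarrow> 1" "(\<lambda>m. ?u (2 * m + 1)) \<longlonglongrightarrow> 1"
    by (rule filterlim_compose[OF lim], rule filterlim_subseq, simp add: strict_mono_def)+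
  then have "(\<lambda>m. ?u (2 * m) / ?u (2 * m + 1) / \<phi>) \<longlonglongrightarrow> 1 / 1 / \<phi>"
    using pos by (intro tendsto_intros) auto
  also have "(\<lambda>m. ?u (2 * m) / ?u (2 * m + 1) / \<phi>) = (\<lambda>m. real (fib (2 * m)) / real (fib (2 * m + 1)))"
    using pos by (auto simp: fun_eq_iff field_simps)
  also have "1 / 1 / \<phi> = (sqrt 5 - 1) / 2"
    using pos by (simp add: \<phi>_def field_simps)
  finally show ?thesis .
qed

text \<open>
  After division by \<open>m * b m\<close> only the terms with a factor \<open>m\<close> survive, and the limit is
  \<open>4 * (25 * r + 40) / (380 * r + 615)\<close>, where \<open>r = (sqrt 5 - 1) / 2\<close> is the limit of \<open>a m / b m\<close>.
\<close>

lemma leaf_ratio_limit: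
  defines "a \<equiv> \<lambda>m. real (fib (2 * m))" and "b \<equiv> \<lambda>m. real (fib (2 * m + 1))"
  shows "(\<lambda>m. 4 * (real m * (25 * a m + 40 * b m) + 244 * a m + 392 * b m + 8 * (- 1) ^ m) /
      (real m * (380 * a m + 615 * b m) + 1900 * a m + 3075 * b m + (50 + 10 * real m) * (- 1) ^ m))
    \<longlonglongrightarrow> - 6 + 14 * sqrt 5 / 5" (is "?q \<longlonglongrightarrow> _")
proof -
  let ?s = "sqrt 5 :: real"
  define r where "r = (\<lambda>m. a m / b m)"
  define e where "e = (\<lambda>m. (- 1) ^ m / b m)"
  have b: "real m < b m" for m
    using fib_odd_gt[of m] by (simp add: b_def del: fib.simps)
  then have b0: "b m > 0" for m
    by (rule le_less_trans[rotated]) simp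
  have r: "r \<longlonglongrightarrow> (?s - 1) / 2"
    unfolding r_def a_def b_def by (rule fib_even_odd_ratio)
  have inv: "(\<lambda>m. 1 / real m) \<longlonglongrightarrow> 0"
    by (rule lim_1_over_n)
  have e: "e \<longlonglongrightarrow> 0"
  proof (rule tendsto_0_le[OF inv])
    show "\<forall>\<^sub>F m in sequentially. norm (e m) \<le> norm (1 / real m) * 1"
      using eventually_gt_at_top[of 0]
    proof eventually_elim
      case (elim m)
      then show ?case
        using b[of m] b0[of m] by (simp add: e_def norm_divide norm_power frac_le)
    qed
  qed
  let ?q' = "\<lambda>m. 4 * ((25 * r m + 40) + (1 / real m) * (244 * r m + 392 + 8 * e m)) /
      ((380 * r m + 615) + (1 / real m) * (1900 * r m + 3075 + 50 * e m) + 10 * e m)"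
  let ?L = "4 * ((25 * ((?s - 1) / 2) + 40) + 0 * (244 * ((?s - 1) / 2) + 392 + 8 * 0)) /
      ((380 * ((?s - 1) / 2) + 615) + 0 * (1900 * ((?s - 1) / 2) + 3075 + 50 * 0) + 10 * 0)"
  have den: "85 + 38 * ?s > 0"
    by (simp add: add_pos_nonneg)
  then have "?q' \<longlonglongrightarrow> ?L"
    by (intro tendsto_intros r e inv) (simp add: field_simps)
  also have "?L = - 6 + 14 * ?s / 5"
    using den by (simp add: field_simps)
  finally have "?q' \<longlonglongrightarrow> - 6 + 14 * ?s / 5" .
  moreover have "\<forall>\<^sub>F m in sequentially. ?q' m = ?q m"
    using eventually_gt_at_top[of 0]
  proof eventually_elim
    case (elim m)
    have "a m = r m * b m" "(- 1) ^ m = e m * b m"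
      using b0[of m] by (simp_all add: r_def e_def)
    then have "4 * (real m * (25 * a m + 40 * b m) + 244 * a m + 392 * b m + 8 * (- 1) ^ m) =
        (real m * b m) * (4 * ((25 * r m + 40) + (1 / real m) * (244 * r m + 392 + 8 * e m)))"
      "real m * (380 * a m + 615 * b m) + 1900 * a m + 3075 * b m + (50 + 10 * real m) * (- 1) ^ m =
        (real m * b m) * ((380 * r m + 615) + (1 / real m) * (1900 * r m + 3075 + 50 * e m) + 10 * e m)"
      using elim by (simp_all add: field_simps)
    then show ?case
      using elim b0[of m] by (simp only: mult_divide_mult_cancel_left_if) simp
  qed
  ultimately show ?thesis
    by (rule Lim_transform_eventually)
qed

lemma BZ_ratio_squared_cycles:
  assumes "n \<ge> 5"
  shows "BZ_ratio squared_cycles n =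
    4 * real (num_spanning_trees (delete_vertex (squared_cycles n) 0)) /
    real (num_spanning_trees (squared_cycles n))"
proof -
  let ?t = "\<lambda>v. num_spanning_trees (delete_vertex (squared_cycles n) v)"
  have eq: "?t v = ?t 0" if "v < n" for v
    using num_spanning_trees_delete_vertex[OF assms that] num_spanning_trees_delete_vertex[OF assms, of 0] assms
    by simp
  have "(\<Sum>T \<in> spanning_trees (squared_cycles n). card (leaves T)) =
      (\<Sum>v<n. degree (squared_cycles n) v * ?t v)"
    using assms sum_leaves[OF simple_squared_cycles, of n] by (simp add: verts_squared_cycles)
  also have "\<dots> = (\<Sum>v<n. 4 * ?t 0)"
  proof (rule sum.cong[OF refl])
    fix v assume "v \<in> {..<n}"
    then show "degree (squared_cycles n) v * ?t v = 4 * ?t 0"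
      using eq[of v] degree_squared_cycles[OF assms, of v] by simp
  qed
  finally show ?thesis
    using assms by (simp add: BZ_ratio_def)
qed

theorem theorem5p3p1:
  shows "convergent (BZ_ratio squared_cycles) \<and>
         BZ_constant squared_cycles = - 6 + 14 * sqrt 5 / 5"
proof -
  have "(\<lambda>m. BZ_ratio squared_cycles (m + 5)) \<longlonglongrightarrow> - 6 + 14 * sqrt 5 / 5"
  proof (rule Lim_transform_eventually[OF leaf_ratio_limit always_eventually], rule allI)
    fix m :: nat
    let ?a = "int (fib (2 * m))" and ?b = "int (fib (2 * m + 1))"
    let ?M = "num_spanning_trees (delete_vertex (squared_cycles (m + 5)) 0)"
    let ?N = "num_spanning_trees (squared_cycles (m + 5))"
    have "int (25 * ?M) = int m * (25 * ?a + 40 * ?b) + 244 * ?a + 392 * ?b + 8 * (- 1) ^ m"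
      using num_spanning_trees_delete_vertex[of "m + 5" 0]
      by simp
    then have "real_of_int (int (25 * ?M)) = real_of_int \<dots>"
      by (rule arg_cong)
    then have M: "25 * real ?M = real m * (25 * real (fib (2 * m)) + 40 * real (fib (2 * m + 1))) +
        244 * real (fib (2 * m)) + 392 * real (fib (2 * m + 1)) + 8 * (- 1) ^ m"
      by simp
    have three: "m + 5 - 2 = m + 3" "2 * (m + 3) = Suc (Suc (Suc (Suc (Suc (Suc (2 * m))))))"
      by simp_all
    \<comment> \<open>The cycle on \<open>m + 5\<close> vertices is a squared path with \<open>m + 3\<close> inner vertices, the cycle without a
      vertex one with \<open>m\<close>; both are expressed through the same two Fibonacci numbers.\<close>
    have fib: "int (fib (2 * (m + 3))) = 5 * ?a + 8 * ?b" "int (fib (2 * (m + 3) + 1)) = 8 * ?a + 13 * ?b"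
      unfolding three by simp_all
    have sign: "(- 1 :: int) ^ (m + 3) = - ((- 1) ^ m)"
      by (simp add: power_add)
    have "int (25 * ?N) = int m * (380 * ?a + 615 * ?b) + 1900 * ?a + 3075 * ?b + (50 + 10 * int m) * (- 1) ^ m"
      using num_spanning_trees_squared_cycle[of "m + 5"]
      unfolding three(1) fib sign by (simp add: algebra_simps)
    then have "real_of_int (int (25 * ?N)) = real_of_int \<dots>"
      by (rule arg_cong)
    then have N: "25 * real ?N = real m * (380 * real (fib (2 * m)) + 615 * real (fib (2 * m + 1))) +
        1900 * real (fib (2 * m)) + 3075 * real (fib (2 * m + 1)) + (50 + 10 * real m) * (- 1) ^ m"
      by simp
    show "4 * (real m * (25 * real (fib (2 * m)) + 40 * real (fib (2 * m + 1))) +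
          244 * real (fib (2 * m)) + 392 * real (fib (2 * m + 1)) + 8 * (- 1) ^ m) /
        (real m * (380 * real (fib (2 * m)) + 615 * real (fib (2 * m + 1))) +
          1900 * real (fib (2 * m)) + 3075 * real (fib (2 * m + 1)) + (50 + 10 * real m) * (- 1) ^ m) =
        BZ_ratio squared_cycles (m + 5)"
      unfolding M[symmetric] N[symmetric] by (simp add: BZ_ratio_squared_cycles)
  qed
  then have "BZ_ratio squared_cycles \<longlonglongrightarrow> - 6 + 14 * sqrt 5 / 5"
    by (rule LIMSEQ_offset)
  then show ?thesis
    unfolding BZ_constant_def by (auto simp: convergent_def intro: limI)
qed

end
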